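(* Let $f\in C([0,\infty),\mathbb{R})$ with $f(0)=0$ and let $0<p<1<q$. Consider $$(-\Delta)^s u=\lambda u^p+\mu u^q+f(u),\ u>0\text{ in }\Omega,\qquad u=0\text{ in }\mathbb{R}^N\setminus\Omega,\qquad \lambda,\mu\in\mathbb{R}.$$ (a) If $(f_0)$ holds, then for every $k\in\mathbb{N}$ and $\mu\in\mathbb{R}$ there exists $\lambda_{k,\mu}>0$ such that the problem has at least $k$ distinct positive weak solutions in $X_0^s(\Omega)$ whenever $\lambda\in[-\lambda_{k,\mu},\lambda_{k,\mu}]$. (b) If $(f_\infty)$ holds, then for every $k\in\mathbb{N}$ and $\lambda\in\mathbb{R}$ there exists $\mu_{k,\lambda}>0$ such that the problem has at least $k$ distinct positive weak solutions in $X_0^s(\Omega)$ whenever $\mu\in[-\mu_{k,\lambda},\mu_{k,\lambda}]$.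
   Context: $\Omega\subset\mathbb{R}^N$ ($N>2s$) is a bounded smooth domain, $s\in(0,1)$, $(-\Delta)^s$ the fractional Laplacian, $X_0^s(\Omega)=\{u\in H^s(\mathbb{R}^N): u=0 \text{ a.e. in }\mathbb{R}^N\setminus\Omega\}$. $F(t)=\int_0^tf$. $(f_0)$: $-\infty<\liminf_{t\to0^+}F(t)/t^2\le\limsup_{t\to0^+}F(t)/t^2=+\infty$ and $\liminf_{t\to0^+}f(t)/t<0$. $(f_\infty)$: $-\infty<\liminf_{t\to\infty}F(t)/t^2\le\limsup_{t\to\infty}F(t)/t^2=+\infty$ and $\liminf_{t\to\infty}f(t)/t<0$. Nonlinearities are extended by $0$ for $u\le0$; weak solutions are defined in the standard variational sense in $X_0^s(\Omega)$, positive meaning nontrivial and nonnegative. *)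

theory Defs
  imports "HOL-Analysis.Analysis"
begin

fun Ck_fun :: "nat \<Rightarrow> ('a::euclidean_space \<Rightarrow> real) \<Rightarrow> bool" where
  "Ck_fun 0 f = continuous_on UNIV f"
| "Ck_fun (Suc k) f = (\<exists>Df. (\<forall>x. (f has_derivative Df x) (at x)) \<and> (\<forall>v. Ck_fun k (\<lambda>x. Df x v)))"

definition smooth_fun :: "('a::euclidean_space \<Rightarrow> real) \<Rightarrow> bool" where
  "smooth_fun f \<longleftrightarrow> (\<forall>k. Ck_fun k f)"

definition bounded_smooth_domain :: "'a::euclidean_space set \<Rightarrow> bool" where
  "bounded_smooth_domain \<Omega> \<longleftrightarrow> \<Omega> \<noteq> {} \<and> bounded \<Omega> \<and> connected \<Omega> \<and>
     (\<exists>\<rho>. smooth_fun \<rho> \<and> \<Omega> = {x. \<rho> x < 0} \<and>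
        (\<forall>x. \<rho> x = 0 \<longrightarrow> (\<exists>D. (\<rho> has_derivative D) (at x) \<and> D \<noteq> (\<lambda>_. 0))))"

definition gkernel :: "real \<Rightarrow> 'a::euclidean_space \<Rightarrow> 'a \<Rightarrow> real" where
  "gkernel s x y = 1 / (norm (x - y) powr (real DIM('a) + 2 * s))"

definition Hs :: "real \<Rightarrow> ('a::euclidean_space \<Rightarrow> real) set" where
  "Hs s = {u. u \<in> borel_measurable lborel \<and> integrable lborel (\<lambda>x. (u x)\<^sup>2) \<and>
      integrable (lborel \<Otimes>\<^sub>M lborel) (\<lambda>(x,y). (u x - u y)\<^sup>2 * gkernel s x y)}"

definition X0 :: "real \<Rightarrow> 'a::euclidean_space set \<Rightarrow> ('a \<Rightarrow> real) set" where
  "X0 s \<Omega> = {u \<in> Hs s. AE x in lborel. x \<notin> \<Omega> \<longrightarrow> u x = 0}"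

definition frac_const :: "real \<Rightarrow> 'a::euclidean_space itself \<Rightarrow> real" where
  "frac_const s _ = 1 / (\<integral>\<zeta>. (1 - cos (\<zeta> \<bullet> (SOME b. b \<in> (Basis::'a set)))) * gkernel s \<zeta> (0::'a) \<partial>lborel)"

definition weak_solution :: "real \<Rightarrow> 'a::euclidean_space set \<Rightarrow> (real \<Rightarrow> real) \<Rightarrow> ('a \<Rightarrow> real) \<Rightarrow> bool" where
  "weak_solution s \<Omega> g u \<longleftrightarrow> u \<in> X0 s \<Omega> \<and>
     (\<forall>\<phi>\<in>X0 s \<Omega>.
        integrable (lborel \<Otimes>\<^sub>M lborel) (\<lambda>(x,y). (u x - u y) * (\<phi> x - \<phi> y) * gkernel s x y) \<and>
        integrable lborel (\<lambda>x. g (u x) * \<phi> x) \<and>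
        frac_const s TYPE('a) / 2 *
          (\<integral>z. (case z of (x,y) \<Rightarrow> (u x - u y) * (\<phi> x - \<phi> y) * gkernel s x y) \<partial>(lborel \<Otimes>\<^sub>M lborel))
        = (\<integral>x. g (u x) * \<phi> x \<partial>lborel))"

definition positive_weak_solution :: "real \<Rightarrow> 'a::euclidean_space set \<Rightarrow> (real \<Rightarrow> real) \<Rightarrow> ('a \<Rightarrow> real) \<Rightarrow> bool" where
  "positive_weak_solution s \<Omega> g u \<longleftrightarrow> weak_solution s \<Omega> g u \<and>
     (AE x in lborel. u x \<ge> 0) \<and> \<not> (AE x in lborel. u x = 0)"

definition has_k_positive_solutions :: "nat \<Rightarrow> real \<Rightarrow> 'a::euclidean_space set \<Rightarrow> (real \<Rightarrow> real) \<Rightarrow> bool" where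
  "has_k_positive_solutions k s \<Omega> g \<longleftrightarrow>
     (\<exists>U :: nat \<Rightarrow> 'a \<Rightarrow> real. (\<forall>i<k. positive_weak_solution s \<Omega> g (U i)) \<and>
        (\<forall>i<k. \<forall>j<k. i \<noteq> j \<longrightarrow> \<not> (AE x in lborel. U i x = U j x)))"

definition nonlin :: "real \<Rightarrow> real \<Rightarrow> real \<Rightarrow> real \<Rightarrow> (real \<Rightarrow> real) \<Rightarrow> real \<Rightarrow> real" where
  "nonlin lam \<mu> p q f t = (if t > 0 then lam * t powr p + \<mu> * t powr q + f t else 0)"

definition primF :: "(real \<Rightarrow> real) \<Rightarrow> real \<Rightarrow> real" where
  "primF f t = integral {0..t} f"

definition cond_f0 :: "(real \<Rightarrow> real) \<Rightarrow> bool" where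
  "cond_f0 f \<longleftrightarrow>
     Liminf (at_right 0) (\<lambda>t. ereal (primF f t / t\<^sup>2)) > -\<infinity> \<and>
     Limsup (at_right 0) (\<lambda>t. ereal (primF f t / t\<^sup>2)) = \<infinity> \<and>
     Liminf (at_right 0) (\<lambda>t. ereal (f t / t)) < 0"

definition cond_finf :: "(real \<Rightarrow> real) \<Rightarrow> bool" where
  "cond_finf f \<longleftrightarrow>
     Liminf at_top (\<lambda>t. ereal (primF f t / t\<^sup>2)) > -\<infinity> \<and>
     Limsup at_top (\<lambda>t. ereal (primF f t / t\<^sup>2)) = \<infinity> \<and>
     Liminf at_top (\<lambda>t. ereal (f t / t)) < 0"

end

theory Submission
  imports Defs
begin

text \<open>
Solutions are minimisers of the energy over the order intervals $0 \le u \le d$ for levels $d$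
at which the nonlinearity $h$ is nonpositive. Freezing $h$ at $h(d)$ beyond $d$ and at $0$ below
$0$ does not change the infimum, because cutting a competitor off at $0$ and $d$ only lowers the
energy; hence a minimiser over the order interval is a global minimiser of the frozen problem and
solves the Euler--Lagrange equation. The oscillation of $F$ produces infinitely many distinct
negative minimal energies: they accumulate at $0$ under $(f_0)$ and diverge to $-\infty$ under
$(f_\infty)$. Each minimal energy depends continuously on the coefficient of the perturbation, so
any $k$ of them remain distinct and negative when this coefficient is small.

Minimisers exist without any compact embedding: the energy is submodular,
$E(\max(u,v)) + E(\min(u,v)) \le E(u) + E(v)$, so the pointwise upper limit of a minimising
sequence with summable defects is again minimising by Fatou's lemma.
\<close>

section \<open>The singular kernel\<close>

text \<open>No upper growth bound is imposed on \<open>f\<close> or on \<open>q\<close>, so the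
  unmodified energy need not make sense on all of \<open>X0 s \<Omega>\<close>. Competitors bounded
  by \<open>d\<close> turn the potential term into a bounded function on a set of finite measure,
  and freezing \<open>h\<close> makes its primitive globally Lipschitz. In each regime one power is
  absorbed into \<open>h\<close> with an arbitrary coefficient and the other one is the
  perturbation. Near 0 the exponent \<open>q\<close> > 1 makes \<open>t powr q\<close> negligible
  against \<open>t\<close>; at infinity \<open>p\<close> < 1 does the same for
  \<open>t powr p\<close>. Hence the oscillation conditions survive the absorption. The remaining
  power may destroy them, but on a fixed interval [0,d] it is a bounded term with a small
  coefficient. Minimisers belonging to different \<open>d\<close> might coincide, which is why
  solutions are counted through their energies. The levels satisfy \<open>h d\<close> < 0 strictly,
  so that they remain admissible after perturbation.\<close>

lemma gkernel_nonneg [simp]: "gkernel s x y \<ge> 0"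
  by (simp add: gkernel_def)

lemma gkernel_diff: "gkernel s x y = gkernel s (x - y) 0"
  by (simp add: gkernel_def)

lemma borel_measurable_gkernel [measurable]:
  assumes [measurable]: "f \<in> borel_measurable M" "g \<in> borel_measurable M"
  shows "(\<lambda>z. gkernel s (f z) (g z :: 'a::euclidean_space)) \<in> borel_measurable M"
  unfolding gkernel_def by measurable

text \<open>The integrand decays like \<open>norm z powr (2 - N - 2 * s)\<close> at 0 and
  \<open>norm z powr (- N - 2 * s)\<close> at infinity. Over dyadic annuli this gives two geometric
  series, whose ratios are below 1 because \<open>s\<close> < 1 and \<open>s\<close> > 0
  respectively.\<close>

lemma nn_integral_min_gkernel_finite:
  assumes s: "0 < s" "s < 1"
  shows "(\<integral>\<^sup>+z. ennreal (min 1 ((norm z)\<^sup>2) * gkernel s z (0::'a::euclidean_space)) \<partial>lborel) < \<infinity>"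
proof -
  define N where "N = real DIM('a)"
  define V where "V = unit_ball_vol (real DIM('a))"
  \<comment> \<open>Upper bounds on the annuli: the kernel is evaluated at the inner radius, and in
    \<open>\<beta>\<close> it is multiplied by the squared outer radius,
    \<open>4 * 2 powr (- 2 * k)\<close>.\<close>
  define \<alpha> :: "nat \<Rightarrow> real" where "\<alpha> k = 2 powr (- (real k * (N + 2 * s)))" for k
  define \<beta> :: "nat \<Rightarrow> real" where "\<beta> k = 4 * 2 powr (real k * (N + 2 * s) - 2 * real k)" for k
  define S where "S k z = ennreal (\<alpha> k) * indicator (cball (0::'a) (2 powr (real k + 1))) z
     + ennreal (\<beta> k) * indicator (cball 0 (2 powr (1 - real k))) z" for k z
  have N: "N > 0" by (simp add: N_def)
  have V: "V \<ge> 0" by (simp add: V_def)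
  \<comment> \<open>\<open>S k\<close> dominates the integrand on the two dyadic annuli of inner radius \<open>2 powr k\<close> and \<open>2 powr (-k)\<close>.\<close>
  have bound: "ennreal (min 1 ((norm z)\<^sup>2) * gkernel s z 0) \<le> (\<Sum>k. S k z)" for z :: 'a
  proof (cases "z = 0")
    case True
    then show ?thesis by simp
  next
    case False
    define j where "j = \<lfloor>log 2 (norm z)\<rfloor>"
    have nz: "norm z = 2 powr (log 2 (norm z))" using False by simp
    have lo: "2 powr (real_of_int j) \<le> norm z"
      by (subst nz, rule powr_mono) (auto simp: j_def)
    have hi: "norm z \<le> 2 powr (real_of_int j + 1)"
      by (subst nz, rule powr_mono) (auto simp: j_def)
    have g: "gkernel s z 0 \<le> 2 powr (- (real_of_int j * (N + 2 * s)))"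
    proof -
      have "(2 powr real_of_int j) powr (N + 2 * s) \<le> norm z powr (N + 2 * s)"
        using lo N s by (intro powr_mono2) auto
      then have "1 / (norm z powr (N + 2 * s)) \<le> 1 / ((2 powr real_of_int j) powr (N + 2 * s))"
        by (intro divide_left_mono) (use False in auto)
      then show ?thesis
        by (simp add: gkernel_def N_def powr_powr powr_minus_divide)
    qed
    have "\<exists>k. ennreal (min 1 ((norm z)\<^sup>2) * gkernel s z 0) \<le> S k z"
    proof (cases "j \<ge> 0")
      case True
      then have k: "real (nat j) = real_of_int j" by simp
      have "min 1 ((norm z)\<^sup>2) * gkernel s z 0 \<le> 1 * \<alpha> (nat j)"
        using g by (intro mult_mono) (auto simp: \<alpha>_def k)
      then have "ennreal (min 1 ((norm z)\<^sup>2) * gkernel s z 0) \<le> ennreal (\<alpha> (nat j))"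
        by (simp add: ennreal_leI)
      moreover have "ennreal (\<alpha> (nat j)) \<le> S (nat j) z"
        using hi by (simp add: S_def k)
      ultimately show ?thesis using order_trans by blast
    next
      case False
      then have k: "real (nat (-j)) = - real_of_int j" by simp
      have "(norm z)\<^sup>2 \<le> (2 powr (real_of_int j + 1))\<^sup>2"
        using hi by (intro power_mono) auto
      also have "\<dots> = 4 * 2 powr (2 * real_of_int j)"
        by (simp add: powr_add power_mult_distrib powr_power mult.commute)
      finally have "min 1 ((norm z)\<^sup>2) \<le> 4 * 2 powr (2 * real_of_int j)" by simp
      then have "min 1 ((norm z)\<^sup>2) * gkernel s z 0
           \<le> (4 * 2 powr (2 * real_of_int j)) * 2 powr (- (real_of_int j * (N + 2 * s)))"
        using g by (intro mult_mono) auto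
      also have "\<dots> = \<beta> (nat (-j))"
        by (simp add: \<beta>_def k powr_add[symmetric] algebra_simps)
      finally have "ennreal (min 1 ((norm z)\<^sup>2) * gkernel s z 0) \<le> ennreal (\<beta> (nat (-j)))"
        by (simp add: ennreal_leI)
      moreover have "ennreal (\<beta> (nat (-j))) \<le> S (nat (-j)) z"
        using hi by (simp add: S_def k add.commute)
      ultimately show ?thesis using order_trans by blast
    qed
    then obtain k where "ennreal (min 1 ((norm z)\<^sup>2) * gkernel s z 0) \<le> S k z" ..
    also have "S k z \<le> (\<Sum>k. S k z)"
      using sum_le_suminf[of "\<lambda>k. S k z" "{k}"] by simp
    finally show ?thesis .
  qed
  have [measurable]: "S k \<in> borel_measurable lborel" for k
    unfolding S_def
    by (intro borel_measurable_add borel_measurable_times_ennreal borel_measurable_const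
        borel_measurable_indicator) auto
  have int: "(\<integral>\<^sup>+z. S k z \<partial>lborel) = 
      ennreal (V * 2 powr N * (2 powr (-2 * s)) ^ k + 4 * V * 2 powr N * (2 powr (-(2-2 * s))) ^ k)" for k
  proof -
    have 1: "\<alpha> k * (V * (2 powr (real k + 1)) ^ DIM('a)) = V * 2 powr N * (2 powr (-2 * s)) ^ k"
      by (simp add: \<alpha>_def powr_power powr_add[symmetric] N_def algebra_simps)
    have 2: "\<beta> k * (V * (2 powr (1 - real k)) ^ DIM('a)) = 4 * V * 2 powr N * (2 powr (-(2-2 * s))) ^ k"
      by (simp add: \<beta>_def powr_power powr_add[symmetric] N_def algebra_simps)
    have "(\<integral>\<^sup>+z. S k z \<partial>lborel) = ennreal (\<alpha> k) * emeasure lborel (cball (0::'a) (2 powr (real k + 1)))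
       + ennreal (\<beta> k) * emeasure lborel (cball (0::'a) (2 powr (1 - real k)))"
      unfolding S_def by (subst nn_integral_add) (auto simp: nn_integral_cmult_indicator
          intro!: borel_measurable_times_ennreal borel_measurable_indicator)
    also have "\<dots> = ennreal (\<alpha> k * (V * (2 powr (real k + 1)) ^ DIM('a)))
       + ennreal (\<beta> k * (V * (2 powr (1 - real k)) ^ DIM('a)))"
      by (simp add: emeasure_cball V_def ennreal_mult \<alpha>_def \<beta>_def)
    also have "\<dots> = ennreal (V * 2 powr N * (2 powr (-2 * s)) ^ k) + ennreal (4 * V * 2 powr N * (2 powr (-(2-2 * s))) ^ k)"
      by (simp only: 1 2)
    finally show ?thesis using V by simp
  qed
  have pw: "(2::real) powr (-2 * s) < 1" "(2::real) powr (-(2-2 * s)) < 1"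
    using s powr_less_mono[of "-2 * s" 0 "2::real"] powr_less_mono[of "-(2-2 * s)" 0 "2::real"] by simp_all
  have "summable (\<lambda>k. V * 2 powr N * (2 powr (-2 * s)) ^ k + 4 * V * 2 powr N * (2 powr (-(2-2 * s))) ^ k)"
    using pw by (intro summable_add summable_mult summable_geometric) simp_all
  then have fin: "(\<Sum>k. ennreal (V * 2 powr N * (2 powr (-2 * s)) ^ k + 4 * V * 2 powr N * (2 powr (-(2-2 * s))) ^ k)) < \<infinity>"
    using V by (subst suminf_ennreal_eq[OF _ summable_sums]) (auto simp del: ennreal_plus)
  have "(\<integral>\<^sup>+z. ennreal (min 1 ((norm z)\<^sup>2) * gkernel s z (0::'a)) \<partial>lborel) \<le> (\<integral>\<^sup>+z. (\<Sum>k. S k z) \<partial>lborel)"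
    by (intro nn_integral_mono bound)
  also have "\<dots> = (\<Sum>k. \<integral>\<^sup>+z. S k z \<partial>lborel)"
    by (intro nn_integral_suminf) measurable
  finally show ?thesis using fin int by (simp add: le_less_trans)
qed

section \<open>Positivity of the normalising constant of the fractional Laplacian\<close>

lemma one_minus_cos_le: "1 - cos x \<le> 2 * min 1 (x\<^sup>2)" for x :: real
proof -
  have "cos x = 1 - 2 * (sin (x/2))\<^sup>2" using cos_double_sin[of "x/2"] by simp
  moreover have "(sin (x/2))\<^sup>2 \<le> (x/2)\<^sup>2"
    using abs_sin_x_le_abs_x[of "x/2"] by (simp only: abs_le_square_iff)
  moreover have "(x/2)\<^sup>2 \<le> x\<^sup>2" by (simp add: power_divide)
  moreover have "cos x \<ge> -1" by simp
  ultimately show ?thesis by (simp add: min_def)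
qed

text \<open>The constant is a reciprocal, and both a non-integrable integrand and a zero integral
  would make it 0. So integrability and strict positivity of the integral both have to be
  proved.\<close>

lemma frac_const_pos:
  assumes s: "0 < s" "s < 1"
  shows "frac_const s TYPE('a::euclidean_space) > 0"
proof -
  define b where "b = (SOME b. b \<in> (Basis::'a set))"
  have b: "b \<in> Basis" unfolding b_def by (rule someI_ex) (use nonempty_Basis in blast)
  define G where "G z = (1 - cos (z \<bullet> b)) * gkernel s z (0::'a)" for z
  have Gm [measurable]: "G \<in> borel_measurable lborel" unfolding G_def by measurable
  have G0: "G z \<ge> 0" for z by (simp add: G_def)
  have G2: "G z \<le> 2 * (min 1 ((norm z)\<^sup>2) * gkernel s z 0)" for z
  proof -
    have "(z \<bullet> b)\<^sup>2 \<le> (norm z)\<^sup>2"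
      using Basis_le_norm[OF b, of z] by (simp add: abs_le_square_iff[symmetric])
    then have "1 - cos (z \<bullet> b) \<le> 2 * min 1 ((norm z)\<^sup>2)"
      using one_minus_cos_le[of "z \<bullet> b"] by linarith
    from mult_right_mono[OF this, of "gkernel s z 0"] show ?thesis
      by (simp add: G_def mult.assoc)
  qed
  have "(\<integral>\<^sup>+z. ennreal (G z) \<partial>lborel) \<le> (\<integral>\<^sup>+z. 2 * ennreal (min 1 ((norm z)\<^sup>2) * gkernel s z (0::'a)) \<partial>lborel)"
    using ennreal_leI[OF G2] by (intro nn_integral_mono) (simp add: ennreal_mult)
  also have "\<dots> = 2 * (\<integral>\<^sup>+z. ennreal (min 1 ((norm z)\<^sup>2) * gkernel s z (0::'a)) \<partial>lborel)"
    by (intro nn_integral_cmult) measurable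
  also have "\<dots> < \<infinity>" using nn_integral_min_gkernel_finite[OF s, where 'a='a]
    by (simp add: ennreal_mult_less_top)
  finally have int: "integrable lborel G"
    using G0 by (simp add: integrable_iff_bounded)
  have "integral\<^sup>L lborel G \<noteq> 0"
  proof
    assume "integral\<^sup>L lborel G = 0"
    then have "AE z in lborel. G z = 0"
      using integral_nonneg_eq_0_iff_AE[OF int] G0 by simp
    \<comment> \<open>On this ball 0 < \<open>z \<bullet> b\<close> < 1 < pi, where the cosine is
      below 1; it is a set of positive measure on which \<open>G\<close> does not vanish.\<close>
    moreover have "G z \<noteq> 0" if z: "z \<in> ball (b /\<^sub>R 2) (1/4)" for z
    proof -
      have "\<bar>(z - b /\<^sub>R 2) \<bullet> b\<bar> < 1/4"
        using z Basis_le_norm[OF b, of "z - b /\<^sub>R 2"] by (simp add: dist_norm norm_minus_commute)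
      then have "0 < z \<bullet> b" "z \<bullet> b < 1"
        using b by (auto simp: inner_diff_left abs_if split: if_splits)
      then have "cos (z \<bullet> b) < cos 0" by (intro cos_monotone_0_pi) (use pi_gt3 in auto)
      moreover have "z \<noteq> 0" using \<open>0 < z \<bullet> b\<close> by auto
      ultimately show ?thesis by (simp add: G_def gkernel_def)
    qed
    ultimately have "AE z in lborel. z \<notin> ball (b /\<^sub>R 2) (1/4)" by (auto elim: eventually_mono)
    then have "emeasure lborel (ball (b /\<^sub>R 2) (1/4)) = 0"
      by (subst (asm) AE_iff_measurable[OF _ refl]) (auto simp del: mem_ball)
    then show False by (simp add: emeasure_ball unit_ball_vol_pos less_imp_neq[symmetric] flip: not_less)
  qed
  moreover have "integral\<^sup>L lborel G \<ge> 0" using G0 by simp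
  ultimately have "1 / integral\<^sup>L lborel G > 0" by simp
  then show ?thesis unfolding frac_const_def G_def b_def by simp
qed

section \<open>The Gagliardo form and the space \<open>X0\<close>\<close>

text \<open>Only the integrand of the squared Gagliardo seminorm, so that inequalities between
  seminorms can be proved pointwise on pairs.\<close>

definition gagliardo :: "real \<Rightarrow> ('a::euclidean_space \<Rightarrow> real) \<Rightarrow> 'a \<times> 'a \<Rightarrow> real" where
  "gagliardo s u = (\<lambda>(x, y). (u x - u y)\<^sup>2 * gkernel s x y)"

lemma gagliardo_nonneg [simp]: "gagliardo s u z \<ge> 0"
  by (simp add: gagliardo_def split: prod.split)

lemma gagliardo_measurable [measurable]:
  assumes [measurable]: "u \<in> borel_measurable borel"
  shows "gagliardo s u \<in> borel_measurable (lborel \<Otimes>\<^sub>M lborel)"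
  unfolding gagliardo_def by measurable

lemma gagliardo_scale: "gagliardo s (\<lambda>x. t * u x) = (\<lambda>z. t\<^sup>2 * gagliardo s u z)"
  by (rule ext)
     (simp add: gagliardo_def case_prod_unfold power_mult_distrib flip: right_diff_distrib)

lemma gagliardo_mono:
  assumes "\<bar>v (fst z) - v (snd z)\<bar> \<le> \<bar>u (fst z) - u (snd z)\<bar>"
  shows "gagliardo s v z \<le> gagliardo s u z"
  using assms by (simp add: gagliardo_def case_prod_unfold abs_le_square_iff mult_right_mono)

text \<open>The exceptional pairs lie in a union of two null strips over the exceptional set. This
  carries almost-everywhere identities of functions over to the two-point integrand
  \<open>gagliardo\<close>.\<close>

lemma AE_lborel_pair:
  assumes "AE x in lborel. P (x :: 'a::euclidean_space)"
  shows "AE z in lborel \<Otimes>\<^sub>M lborel. P (fst z) \<and> P (snd z)"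
proof -
  obtain N where N: "N \<in> null_sets lborel" "{x. \<not> P x} \<subseteq> N"
    using assms by (auto simp: eventually_ae_filter)
  have "N \<in> sets lborel" "emeasure lborel N = 0" using N(1) by auto
  then have "N \<times> (UNIV :: 'a set) \<in> null_sets (lborel \<Otimes>\<^sub>M lborel)" 
            "(UNIV :: 'a set) \<times> N \<in> null_sets (lborel \<Otimes>\<^sub>M lborel)"
    using lborel.emeasure_pair_measure_Times[of N lborel UNIV] lborel.emeasure_pair_measure_Times[of "UNIV :: 'a set" lborel N]
    by (auto intro!: null_setsI simp: pair_measureI)
  then have "N \<times> UNIV \<union> UNIV \<times> N \<in> null_sets (lborel \<Otimes>\<^sub>M lborel)" by (rule null_sets.Un)
  then show ?thesis
    by (rule AE_I') (use N(2) in auto)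
qed

text \<open>The polarisation of \<open>gagliardo\<close>, that is, the integrand of the bilinear
  form in the weak formulation.\<close>

definition gcross :: "real \<Rightarrow> ('a::euclidean_space \<Rightarrow> real) \<Rightarrow> ('a \<Rightarrow> real) \<Rightarrow> 'a \<times> 'a \<Rightarrow> real" where
  "gcross s u v = (\<lambda>(x, y). (u x - u y) * (v x - v y) * gkernel s x y)"

lemma gcross_measurable [measurable]:
  assumes [measurable]: "u \<in> borel_measurable borel" "v \<in> borel_measurable borel"
  shows "gcross s u v \<in> borel_measurable (lborel \<Otimes>\<^sub>M lborel)"
  unfolding gcross_def by measurable

lemma abs_mult_le_squares: "\<bar>a * b\<bar> \<le> a\<^sup>2 + b\<^sup>2" for a b :: real
proof -
  have "2 * (\<bar>a\<bar> * \<bar>b\<bar>) \<le> a\<^sup>2 + b\<^sup>2" using sum_squares_bound[of "\<bar>a\<bar>" "\<bar>b\<bar>"] by simp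
  moreover have "0 \<le> \<bar>a\<bar> * \<bar>b\<bar>" by simp
  ultimately show ?thesis unfolding abs_mult by linarith
qed

lemma integrable_gcross:
  assumes "u \<in> borel_measurable borel" "v \<in> borel_measurable borel"
    and "integrable (lborel \<Otimes>\<^sub>M lborel) (gagliardo s u)" "integrable (lborel \<Otimes>\<^sub>M lborel) (gagliardo s v)"
  shows "integrable (lborel \<Otimes>\<^sub>M lborel) (gcross s u v)"
proof (rule Bochner_Integration.integrable_bound[OF Bochner_Integration.integrable_add[OF assms(3,4)]])
  have "\<bar>gcross s u v z\<bar> \<le> gagliardo s u z + gagliardo s v z" for z
    using mult_right_mono[OF abs_mult_le_squares gkernel_nonneg]
    by (simp add: gcross_def gagliardo_def case_prod_unfold abs_mult distrib_right)
  then show "AE z in lborel \<Otimes>\<^sub>M lborel. norm (gcross s u v z) \<le> norm (gagliardo s u z + gagliardo s v z)"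
    by (intro AE_I2) (simp add: abs_of_nonneg)
qed (use assms in measurable)

lemma gagliardo_add:
  "gagliardo s (\<lambda>x. u x + t * v x) z = gagliardo s u z + 2 * t * gcross s u v z + t\<^sup>2 * gagliardo s v z"
  by (simp add: gagliardo_def gcross_def case_prod_unfold power2_eq_square algebra_simps)

lemma X0_iff:
  "u \<in> X0 s \<Omega> \<longleftrightarrow> u \<in> borel_measurable borel \<and> integrable lborel (\<lambda>x. (u x)\<^sup>2) \<and>
     integrable (lborel \<Otimes>\<^sub>M lborel) (gagliardo s u) \<and> (AE x in lborel. x \<notin> \<Omega> \<longrightarrow> u x = 0)"
  by (simp add: X0_def Hs_def gagliardo_def)

lemma X0_add:
  assumes "u \<in> X0 s \<Omega>" "v \<in> X0 s \<Omega>"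
  shows "(\<lambda>x. u x + t * v x) \<in> X0 s \<Omega>"
    and "integral\<^sup>L (lborel \<Otimes>\<^sub>M lborel) (gagliardo s (\<lambda>x. u x + t * v x)) =
      integral\<^sup>L (lborel \<Otimes>\<^sub>M lborel) (gagliardo s u) + 2 * t * integral\<^sup>L (lborel \<Otimes>\<^sub>M lborel) (gcross s u v)
        + t\<^sup>2 * integral\<^sup>L (lborel \<Otimes>\<^sub>M lborel) (gagliardo s v)"
proof -
  have [measurable]: "u \<in> borel_measurable borel" "v \<in> borel_measurable borel"
    and u2: "integrable lborel (\<lambda>x. (u x)\<^sup>2)" and v2: "integrable lborel (\<lambda>x. (v x)\<^sup>2)"
    and gu: "integrable (lborel \<Otimes>\<^sub>M lborel) (gagliardo s u)" and gv: "integrable (lborel \<Otimes>\<^sub>M lborel) (gagliardo s v)"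
    and u0: "AE x in lborel. x \<notin> \<Omega> \<longrightarrow> u x = 0" and v0: "AE x in lborel. x \<notin> \<Omega> \<longrightarrow> v x = 0"
    using assms by (auto simp: X0_iff)
  have gc: "integrable (lborel \<Otimes>\<^sub>M lborel) (gcross s u v)"
    by (intro integrable_gcross gu gv) auto
  have g: "gagliardo s (\<lambda>x. u x + t * v x) = (\<lambda>z. gagliardo s u z + 2 * t * gcross s u v z + t\<^sup>2 * gagliardo s v z)"
    by (rule ext) (rule gagliardo_add)
  have uv: "integrable lborel (\<lambda>x. u x * v x)"
    by (rule Bochner_Integration.integrable_bound[OF Bochner_Integration.integrable_add[OF u2 v2]])
       (auto intro!: AE_I2 simp: abs_mult_le_squares)
  have "(u x + t * v x)\<^sup>2 = (u x)\<^sup>2 + 2 * t * (u x * v x) + t\<^sup>2 * (v x)\<^sup>2" for x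
    by (simp add: power2_eq_square algebra_simps)
  then have "integrable lborel (\<lambda>x. (u x + t * v x)\<^sup>2)"
    using u2 v2 uv by simp
  moreover have "integrable (lborel \<Otimes>\<^sub>M lborel) (gagliardo s (\<lambda>x. u x + t * v x))"
    unfolding g using gu gv gc by simp
  moreover have "AE x in lborel. x \<notin> \<Omega> \<longrightarrow> u x + t * v x = 0"
    using u0 v0 by eventually_elim simp
  ultimately show "(\<lambda>x. u x + t * v x) \<in> X0 s \<Omega>" by (simp add: X0_iff)
  show "integral\<^sup>L (lborel \<Otimes>\<^sub>M lborel) (gagliardo s (\<lambda>x. u x + t * v x)) =
      integral\<^sup>L (lborel \<Otimes>\<^sub>M lborel) (gagliardo s u) + 2 * t * integral\<^sup>L (lborel \<Otimes>\<^sub>M lborel) (gcross s u v)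
        + t\<^sup>2 * integral\<^sup>L (lborel \<Otimes>\<^sub>M lborel) (gagliardo s v)"
    unfolding g using gu gv gc by simp
qed

section \<open>Finite Gagliardo energy of Lipschitz cutoffs\<close>

lemma nn_integral_lborel_diff:
  fixes J :: "'a::euclidean_space \<Rightarrow> ennreal"
  assumes [measurable]: "J \<in> borel_measurable borel"
  shows "(\<integral>\<^sup>+y. J (y - x) \<partial>lborel) = (\<integral>\<^sup>+y. J y \<partial>lborel)"
proof -
  have "(\<integral>\<^sup>+y. J y \<partial>lborel) = (\<integral>\<^sup>+y. J y \<partial>distr lborel borel ((+) (- x)))"
    by (simp add: lborel_distr_plus)
  also have "\<dots> = (\<integral>\<^sup>+y. J (y - x) \<partial>lborel)"
    by (subst nn_integral_distr) auto
  finally show ?thesis ..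
qed

text \<open>The integrand vanishes unless one of the two points lies in \<open>B\<close>. Tonelli,
  integrating the other point first, then yields the measure of \<open>B\<close> times the
  translation-invariant integral of \<open>J\<close>, once for each point.\<close>

lemma lipschitz_gagliardo_integrable:
  fixes \<phi> :: "'a::euclidean_space \<Rightarrow> real"
  assumes s: "0 < s" "s < 1" and \<phi>m [measurable]: "\<phi> \<in> borel_measurable borel"
    and B [measurable]: "B \<in> sets borel" and fin: "emeasure lborel B < \<infinity>"
    and off: "\<And>x. x \<notin> B \<Longrightarrow> \<phi> x = 0"
    and lip: "\<And>x y. (\<phi> x - \<phi> y)\<^sup>2 \<le> C * min 1 ((norm (x - y))\<^sup>2)" and C: "C \<ge> 0"
  shows "integrable (lborel \<Otimes>\<^sub>M lborel) (gagliardo s \<phi>)"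
proof -
  define J where "J z = ennreal (min 1 ((norm z)\<^sup>2) * gkernel s z (0::'a))" for z
  have [measurable]: "J \<in> borel_measurable borel" unfolding J_def by measurable
  have Jfin: "(\<integral>\<^sup>+z. J z \<partial>lborel) < \<infinity>" unfolding J_def by (rule nn_integral_min_gkernel_finite[OF s])
  have J': "J (x - y) = J (y - x)" for x y
    by (simp add: J_def norm_minus_commute gkernel_def)
  have le: "ennreal (gagliardo s \<phi> (x, y)) \<le> ennreal C * (indicator B x * J (y - x) + indicator B y * J (x - y))" for x y
  proof (cases "x \<in> B \<or> y \<in> B")
    case True
    have "gagliardo s \<phi> (x, y) \<le> C * (min 1 ((norm (x - y))\<^sup>2) * gkernel s (x - y) 0)"
      using mult_right_mono[OF lip gkernel_nonneg, of x y s x y]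
      by (simp add: gagliardo_def mult.assoc flip: gkernel_diff)
    then have "ennreal (gagliardo s \<phi> (x, y)) \<le> ennreal C * J (x - y)"
      using C by (simp add: J_def ennreal_leI flip: ennreal_mult)
    also have "J (x - y) \<le> indicator B x * J (y - x) + indicator B y * J (x - y)"
      using True by (auto simp: J' indicator_def)
    finally show ?thesis by (simp add: mult_left_mono)
  next
    case False
    then show ?thesis by (simp add: gagliardo_def off)
  qed
  have 1: "(\<integral>\<^sup>+z. indicator B (fst z) * J (snd z - fst z) \<partial>(lborel \<Otimes>\<^sub>M lborel)) = emeasure lborel B * (\<integral>\<^sup>+z. J z \<partial>lborel)"
    by (subst lborel.nn_integral_fst[symmetric])
       (simp_all add: nn_integral_cmult nn_integral_multc nn_integral_lborel_diff)
  have 2: "(\<integral>\<^sup>+z. indicator B (snd z) * J (fst z - snd z) \<partial>(lborel \<Otimes>\<^sub>M lborel)) = emeasure lborel B * (\<integral>\<^sup>+z. J z \<partial>lborel)"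
    by (subst lborel_pair.nn_integral_snd[symmetric])
       (simp_all add: nn_integral_cmult nn_integral_multc nn_integral_lborel_diff)
  have "(\<integral>\<^sup>+z. ennreal (gagliardo s \<phi> z) \<partial>(lborel \<Otimes>\<^sub>M lborel))
     \<le> (\<integral>\<^sup>+z. ennreal C * (indicator B (fst z) * J (snd z - fst z) + indicator B (snd z) * J (fst z - snd z)) \<partial>(lborel \<Otimes>\<^sub>M lborel))"
    by (intro nn_integral_mono) (use le in auto)
  also have "\<dots> = ennreal C * (emeasure lborel B * (\<integral>\<^sup>+z. J z \<partial>lborel) + emeasure lborel B * (\<integral>\<^sup>+z. J z \<partial>lborel))"
    by (simp add: nn_integral_cmult nn_integral_add 1 2)
  also have "\<dots> < \<infinity>"
    using fin Jfin by (simp add: ennreal_mult_less_top)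
  finally show ?thesis by (simp add: integrable_iff_bounded)
qed

section \<open>Primitives and frozen nonlinearities\<close>

lemma primF_0 [simp]: "primF h 0 = 0"
  by (simp add: primF_def)

lemma continuous_primF:
  assumes "continuous_on {0..d} h"
  shows "continuous_on {0..d} (primF h)"
  unfolding primF_def using assms
  by (intro indefinite_integral_continuous_1 integrable_continuous_interval)

lemma primF_bounded:
  assumes "continuous_on {0..d} h"
  obtains C where "C \<ge> 0" "\<And>t. 0 \<le> t \<Longrightarrow> t \<le> d \<Longrightarrow> \<bar>primF h t\<bar> \<le> C"
proof -
  have "bounded (primF h ` {0..d})"
    using compact_continuous_image[OF continuous_primF[OF assms]] compact_imp_bounded by blast
  then obtain C where "\<And>x. x \<in> primF h ` {0..d} \<Longrightarrow> norm x \<le> C" by (auto simp: bounded_iff)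
  then show ?thesis by (intro that[of "max 0 C"]) (auto simp: le_max_iff_disj)
qed

lemma primF_add_scale:
  assumes "continuous_on {0..t} h" "continuous_on {0..t} e"
  shows "primF (\<lambda>r. h r + c * e r) t = primF h t + c * primF e t"
proof -
  have "integral {0..t} (\<lambda>r. h r + c * e r) = integral {0..t} h + integral {0..t} (\<lambda>r. c * e r)"
    by (rule Henstock_Kurzweil_Integration.integral_add)
       (auto intro!: integrable_continuous_interval continuous_intros assms)
  then show ?thesis by (simp add: primF_def)
qed

text \<open>Clamping the argument keeps continuity and boundedness immediate. Below 0 the value is
  \<open>h 0\<close>, so freezing at 0 relies on \<open>h 0 = 0\<close>.\<close>

definition trunc :: "(real \<Rightarrow> real) \<Rightarrow> real \<Rightarrow> real \<Rightarrow> real" where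
  "trunc h d t = h (max 0 (min d t))"

context
  fixes h :: "real \<Rightarrow> real" and d :: real
  assumes h: "continuous_on {0..d} h" and h0: "h 0 = 0" and d: "d > 0"
begin

lemma continuous_trunc: "continuous_on A (trunc h d)"
  unfolding trunc_def
  by (rule continuous_on_compose2[OF h]) (use d in \<open>auto intro!: continuous_intros\<close>)

lemma trunc_bounded: obtains L where "L \<ge> 0" "\<And>t. \<bar>trunc h d t\<bar> \<le> L"
proof -
  have "bounded (h ` {0..d})"
    using compact_continuous_image[OF h] compact_imp_bounded by blast
  then obtain L where "\<And>x. x \<in> h ` {0..d} \<Longrightarrow> norm x \<le> L" by (auto simp: bounded_iff)
  then have L: "\<bar>trunc h d t\<bar> \<le> L" for t using d by (simp add: trunc_def)
  then show ?thesis using that[of L] L[of 0] by force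
qed

text \<open>For negative \<open>t\<close> the interval \<open>{0..t}\<close> is empty and the
  integral defaults to 0. This agrees with the true antiderivative because \<open>trunc h d\<close>
  vanishes there.\<close>

lemma primF_trunc_neg: "t \<le> 0 \<Longrightarrow> primF (trunc h d) t = 0"
  by (cases "t = 0") (simp_all add: primF_def)

lemma primF_trunc_eq:
  assumes "0 \<le> t" "t \<le> d"
  shows "primF (trunc h d) t = primF h t"
  unfolding primF_def trunc_def
  by (rule Henstock_Kurzweil_Integration.integral_cong) (use assms in auto)

text \<open>A two-sided derivative at \<open>t\<close> \<le> 0 needs a base point of integration to
  the left of \<open>t\<close>. Moving it from 0 to \<open>a\<close> adds nothing, since the
  integrand is 0 on [a,0].\<close>

lemma primF_trunc_shift:
  assumes a: "a < 0" and t: "a < t"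
  shows "primF (trunc h d) t = integral {a..t} (trunc h d)"
proof -
  have zero: "integral {a..r} (trunc h d) = 0" if "r \<le> 0" for r
  proof -
    have "integral {a..r} (trunc h d) = integral {a..r} (\<lambda>_. 0)"
      by (rule Henstock_Kurzweil_Integration.integral_cong) (use that d h0 in \<open>auto simp: trunc_def\<close>)
    then show ?thesis by simp
  qed
  show ?thesis
  proof (cases "t \<le> 0")
    case True
    then show ?thesis using zero primF_trunc_neg by simp
  next
    case False
    have "integral {a..0} (trunc h d) + integral {0..t} (trunc h d) = integral {a..t} (trunc h d)"
      by (rule Henstock_Kurzweil_Integration.integral_combine)
         (use a False in \<open>auto intro!: integrable_continuous_interval continuous_trunc\<close>)
    then show ?thesis using zero[of 0] by (simp add: primF_def)
  qed
qed

lemma primF_trunc_deriv: "(primF (trunc h d) has_real_derivative trunc h d t) (at t)"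
proof -
  define a where "a = min 0 t - 1"
  have a: "a < 0" "a < t" by (auto simp: a_def)
  have "((\<lambda>r. integral {a..r} (trunc h d)) has_real_derivative trunc h d t) (at t within {a..t + 1})"
    by (rule integral_has_real_derivative[OF continuous_trunc]) (use a in auto)
  then have "((\<lambda>r. integral {a..r} (trunc h d)) has_real_derivative trunc h d t) (at t within {a<..<t + 1})"
    by (rule DERIV_subset) auto
  then have "((\<lambda>r. integral {a..r} (trunc h d)) has_real_derivative trunc h d t) (at t)"
    by (subst (asm) at_within_open) (use a in auto)
  then show ?thesis
    by (rule has_field_derivative_transform_within_open[where S="{a<..}"])
       (use a primF_trunc_shift in auto)
qed

lemma primF_trunc_lipschitz:
  assumes "\<And>t. \<bar>trunc h d t\<bar> \<le> L"
  shows "\<bar>primF (trunc h d) a - primF (trunc h d) b\<bar> \<le> L * \<bar>a - b\<bar>"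
  using field_differentiable_bound[of UNIV "primF (trunc h d)" "trunc h d" L a b]
    primF_trunc_deriv assms by simp

lemma primF_trunc_le:
  assumes hd: "h d \<le> 0"
  shows "primF (trunc h d) t \<le> primF h (max 0 (min d t))"
proof -
  consider "t \<le> 0" | "0 \<le> t" "t \<le> d" | "d \<le> t" by linarith
  then show ?thesis
  proof cases
    case 3
    have "primF (trunc h d) t \<le> primF (trunc h d) d"
    proof (rule DERIV_nonpos_imp_nonincreasing[OF 3])
      fix r assume "d \<le> r" "r \<le> t"
      then have "trunc h d r \<le> 0" using hd d by (simp add: trunc_def)
      then show "\<exists>y. (primF (trunc h d) has_real_derivative y) (at r) \<and> y \<le> 0"
        using primF_trunc_deriv by blast
    qed
    then show ?thesis using 3 d primF_trunc_eq[of d] by simp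
  qed (use d primF_trunc_neg primF_trunc_eq in \<open>auto simp: primF_def\<close>)
qed

lemma primF_trunc_borel [measurable]: "primF (trunc h d) \<in> borel_measurable borel"
  by (intro borel_measurable_continuous_onI continuous_at_imp_continuous_on ballI)
     (rule DERIV_isCont[OF primF_trunc_deriv])

lemma trunc_borel [measurable]: "trunc h d \<in> borel_measurable borel"
  by (intro borel_measurable_continuous_onI continuous_trunc)

end

lemma frequently_eventually_ex:
  assumes "\<exists>\<^sub>F x in F. P x" "\<forall>\<^sub>F x in F. Q x"
  shows "\<exists>x. P x \<and> Q x"
proof (rule ccontr)
  assume "\<nexists>x. P x \<and> Q x"
  then have "\<forall>\<^sub>F x in F. \<not> P x" using assms(2) by (auto elim: eventually_mono)
  then show False using assms(1) by (simp add: frequently_def)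
qed

section \<open>Minimisation over order intervals\<close>

locale truncated_problem =
  fixes \<Omega> :: "'a::euclidean_space set" and s \<kappa> :: real
  assumes open_dom: "open \<Omega>" and nonempty_dom: "\<Omega> \<noteq> {}" and bounded_dom: "bounded \<Omega>"
    and s_pos: "0 < s" and s_less: "s < 1" and kappa_pos: "\<kappa> > 0"
begin

text \<open>The bounds and the exterior condition hold everywhere, not just almost everywhere, so
  that pointwise maxima, suprema and limits satisfy them without any choice of representative.
  Square integrability follows from boundedness and the bounded domain.\<close>

definition W :: "real \<Rightarrow> ('a \<Rightarrow> real) set" where
  "W d = {u. u \<in> borel_measurable borel \<and> (\<forall>x. 0 \<le> u x \<and> u x \<le> d) \<and> (\<forall>x. x \<notin> \<Omega> \<longrightarrow> u x = 0) \<and>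
     integrable (lborel \<Otimes>\<^sub>M lborel) (gagliardo s u)}"

definition energy :: "(real \<Rightarrow> real) \<Rightarrow> ('a \<Rightarrow> real) \<Rightarrow> real" where
  "energy h u = \<kappa> * integral\<^sup>L (lborel \<Otimes>\<^sub>M lborel) (gagliardo s u) - (\<integral>x. primF h (u x) \<partial>lborel)"

text \<open>A real infimum, meaningful through \<open>zero_in_W\<close> and
  \<open>energy_bdd_below\<close>.\<close>

definition ground :: "(real \<Rightarrow> real) \<Rightarrow> real \<Rightarrow> real" where
  "ground h d = (INF u\<in>W d. energy h u)"

lemma dom_sets [measurable]: "\<Omega> \<in> sets borel"
  using open_dom by simp

lemma dom_finite: "emeasure lborel \<Omega> < \<infinity>"
  by (rule emeasure_bounded_finite[OF bounded_dom])

lemma integrable_indicator_dom: "integrable lborel (indicat_real \<Omega>)"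
  using dom_finite by (intro integrable_real_indicator) auto

section \<open>Bounds for the potential term and the energy\<close>

lemma primF_measurable:
  assumes "continuous_on {0..d} h" "u \<in> W d"
  shows "(\<lambda>x. primF h (u x)) \<in> borel_measurable borel"
proof -
  have "primF h \<in> borel_measurable (restrict_space borel {0..d})"
    by (rule borel_measurable_continuous_on_restrict[OF continuous_primF[OF assms(1)]])
  moreover have "u \<in> measurable borel (restrict_space borel {0..d})"
    using assms(2) by (intro measurable_restrict_space2) (auto simp: W_def)
  ultimately show ?thesis by (rule measurable_compose[rotated])
qed

lemma norm_primF_le:
  assumes "u \<in> W d" "\<And>t. 0 \<le> t \<Longrightarrow> t \<le> d \<Longrightarrow> \<bar>primF h t\<bar> \<le> C"
  shows "norm (primF h (u x)) \<le> C * indicat_real \<Omega> x"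
  using assms by (auto simp: W_def indicator_def)

lemma primF_integrable:
  assumes "continuous_on {0..d} h" "u \<in> W d"
  shows "integrable lborel (\<lambda>x. primF h (u x))"
proof -
  obtain C where C: "C \<ge> 0" "\<And>t. 0 \<le> t \<Longrightarrow> t \<le> d \<Longrightarrow> \<bar>primF h t\<bar> \<le> C"
    using primF_bounded[OF assms(1)] by blast
  have "integrable lborel (\<lambda>x. C * indicat_real \<Omega> x)"
    using integrable_indicator_dom by simp
  then show ?thesis
    by (rule Bochner_Integration.integrable_bound)
       (use primF_measurable[OF assms] norm_primF_le[OF assms(2) C(2)] C(1) in auto)
qed

lemma primF_integral_le:
  assumes "u \<in> W d" "continuous_on {0..d} h" "\<And>t. 0 \<le> t \<Longrightarrow> t \<le> d \<Longrightarrow> \<bar>primF h t\<bar> \<le> C"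
  shows "\<bar>\<integral>x. primF h (u x) \<partial>lborel\<bar> \<le> C * measure lborel \<Omega>"
proof -
  have "norm (\<integral>x. primF h (u x) \<partial>lborel) \<le> (\<integral>x. C * indicat_real \<Omega> x \<partial>lborel)"
    by (intro Bochner_Integration.integral_norm_bound_integral primF_integrable[OF assms(2,1)] norm_primF_le[OF assms(1,3)])
       (use integrable_indicator_dom in auto)
  also have "\<dots> = C * measure lborel \<Omega>" by simp
  finally show ?thesis by simp
qed

lemma energy_ge:
  assumes "u \<in> W d" "continuous_on {0..d} h" "\<And>t. 0 \<le> t \<Longrightarrow> t \<le> d \<Longrightarrow> \<bar>primF h t\<bar> \<le> C"
  shows "energy h u \<ge> - (C * measure lborel \<Omega>)"
proof -
  have "\<kappa> * integral\<^sup>L (lborel \<Otimes>\<^sub>M lborel) (gagliardo s u) \<ge> 0"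
    using kappa_pos by (intro mult_nonneg_nonneg) auto
  then show ?thesis using primF_integral_le[OF assms] by (simp add: energy_def abs_le_iff)
qed

lemma zero_in_W: "d \<ge> 0 \<Longrightarrow> (\<lambda>_. 0) \<in> W d"
  by (simp add: W_def gagliardo_def case_prod_unfold)

lemma energy_bdd_below:
  assumes "continuous_on {0..d} h"
  shows "bdd_below (energy h ` W d)"
proof -
  obtain C where C: "\<And>t. 0 \<le> t \<Longrightarrow> t \<le> d \<Longrightarrow> \<bar>primF h t\<bar> \<le> C"
    using primF_bounded[OF assms(1)] by blast
  show ?thesis
    by (rule bdd_belowI2[where m="- (C * measure lborel \<Omega>)"]) (rule energy_ge[OF _ assms C])
qed

lemma ground_le: "continuous_on {0..d} h \<Longrightarrow> u \<in> W d \<Longrightarrow> ground h d \<le> energy h u"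
  unfolding ground_def by (rule cINF_lower[OF energy_bdd_below])

text \<open>The potential terms balance exactly, because at each point the maximum and the minimum
  are just \<open>u\<close> and \<open>v\<close> in some order. The Gagliardo terms satisfy the
  inequality at each pair of points.\<close>

lemma W_max_min:
  assumes "u \<in> W d" "v \<in> W d"
  shows "(\<lambda>x. max (u x) (v x)) \<in> W d" "(\<lambda>x. min (u x) (v x)) \<in> W d"
    and "continuous_on {0..d} h \<Longrightarrow>
      energy h (\<lambda>x. max (u x) (v x)) + energy h (\<lambda>x. min (u x) (v x)) \<le> energy h u + energy h v"
proof -
  have [measurable]: "u \<in> borel_measurable borel" "v \<in> borel_measurable borel"
    and iu: "integrable (lborel \<Otimes>\<^sub>M lborel) (gagliardo s u)" and iv: "integrable (lborel \<Otimes>\<^sub>M lborel) (gagliardo s v)"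
    using assms by (auto simp: W_def)
  let ?M = "\<lambda>x. max (u x) (v x)" and ?m = "\<lambda>x. min (u x) (v x)"
  \<comment> \<open>After expansion only the mixed products differ, and by the rearrangement
    inequality pairing large with large and small with small gives the larger sum of
    products.\<close>
  have sub: "(max a b - max a' b')\<^sup>2 + (min a b - min a' b')\<^sup>2 \<le> (a - a')\<^sup>2 + (b - b')\<^sup>2" for a b a' b' :: real
  proof -
    have *: "a * b' + a' * b \<le> a * a' + b * b'" if "a \<le> b \<and> a' \<le> b' \<or> b \<le> a \<and> b' \<le> a'" 
      using that mult_nonneg_nonneg[of "b - a" "b' - a'"] mult_nonneg_nonneg[of "a - b" "a' - b'"]
      by (auto simp: algebra_simps)
    have **: "a * a' + b * b' \<le> a * b' + a' * b" if "a \<le> b \<and> b' \<le> a' \<or> b \<le> a \<and> a' \<le> b'" 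
      using that mult_nonneg_nonneg[of "b - a" "a' - b'"] mult_nonneg_nonneg[of "a - b" "b' - a'"]
      by (auto simp: algebra_simps)
    show ?thesis
      by (cases "a \<le> b"; cases "a' \<le> b'") (use * ** in \<open>auto simp: max_def min_def power2_eq_square algebra_simps\<close>)
  qed
  have pt: "gagliardo s ?M z + gagliardo s ?m z \<le> gagliardo s u z + gagliardo s v z" for z
    using mult_right_mono[OF sub[of "u (fst z)" "v (fst z)" "u (snd z)" "v (snd z)"] gkernel_nonneg[of s "fst z" "snd z"]]
    by (simp add: gagliardo_def case_prod_unfold distrib_right)
  have pt1: "norm (gagliardo s ?M z) \<le> norm (gagliardo s u z + gagliardo s v z)"
    and pt2: "norm (gagliardo s ?m z) \<le> norm (gagliardo s u z + gagliardo s v z)" for z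
    using pt[of z] gagliardo_nonneg[of s ?M z] gagliardo_nonneg[of s ?m z] by (simp_all only: real_norm_def)
  have iM: "integrable (lborel \<Otimes>\<^sub>M lborel) (gagliardo s ?M)"
    by (rule Bochner_Integration.integrable_bound[OF Bochner_Integration.integrable_add[OF iu iv]])
       (measurable, use pt1 in \<open>auto intro!: AE_I2\<close>)
  have im: "integrable (lborel \<Otimes>\<^sub>M lborel) (gagliardo s ?m)"
    by (rule Bochner_Integration.integrable_bound[OF Bochner_Integration.integrable_add[OF iu iv]])
       (measurable, use pt2 in \<open>auto intro!: AE_I2\<close>)
  show WM: "?M \<in> W d" and Wm: "?m \<in> W d" using assms iM im by (auto simp: W_def le_max_iff_disj min_le_iff_disj)
  assume h: "continuous_on {0..d} h"
  have "integral\<^sup>L (lborel \<Otimes>\<^sub>M lborel) (gagliardo s ?M) + integral\<^sup>L (lborel \<Otimes>\<^sub>M lborel) (gagliardo s ?m)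
     \<le> integral\<^sup>L (lborel \<Otimes>\<^sub>M lborel) (gagliardo s u) + integral\<^sup>L (lborel \<Otimes>\<^sub>M lborel) (gagliardo s v)"
    by (simp only: Bochner_Integration.integral_add[OF iM im, symmetric] Bochner_Integration.integral_add[OF iu iv, symmetric])
       (intro integral_mono Bochner_Integration.integrable_add iM im iu iv pt)
  from mult_left_mono[OF this, of \<kappa>] kappa_pos
  have 1: "\<kappa> * integral\<^sup>L (lborel \<Otimes>\<^sub>M lborel) (gagliardo s ?M) + \<kappa> * integral\<^sup>L (lborel \<Otimes>\<^sub>M lborel) (gagliardo s ?m)
     \<le> \<kappa> * integral\<^sup>L (lborel \<Otimes>\<^sub>M lborel) (gagliardo s u) + \<kappa> * integral\<^sup>L (lborel \<Otimes>\<^sub>M lborel) (gagliardo s v)"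
    by (simp add: distrib_left)
  have "(\<integral>x. primF h (?M x) \<partial>lborel) + (\<integral>x. primF h (?m x) \<partial>lborel)
      = (\<integral>x. primF h (?M x) + primF h (?m x) \<partial>lborel)"
    by (intro Bochner_Integration.integral_add[symmetric] primF_integrable[OF h] WM Wm)
  also have "\<dots> = (\<integral>x. primF h (u x) + primF h (v x) \<partial>lborel)"
    by (intro Bochner_Integration.integral_cong) (auto simp: max_def min_def)
  also have "\<dots> = (\<integral>x. primF h (u x) \<partial>lborel) + (\<integral>x. primF h (v x) \<partial>lborel)"
    by (intro Bochner_Integration.integral_add primF_integrable[OF h] assms)
  finally show "energy h ?M + energy h ?m \<le> energy h u + energy h v"
    using 1 by (simp add: energy_def)
qed

text \<open>Pointwise convergence suffices: dominated convergence handles the potential, which is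
  bounded on a domain of finite measure, and Fatou handles the Gagliardo term. The energy bound also
  yields the finiteness required for membership of the limit in \<open>W d\<close>.\<close>

lemma energy_lsc:
  assumes h: "continuous_on {0..d} h" and v: "\<And>j. v j \<in> W d"
    and lim: "\<And>x. (\<lambda>j. v j x) \<longlonglongrightarrow> w x" and le: "\<And>j. energy h (v j) \<le> C"
  shows "w \<in> W d" "energy h w \<le> C"
proof -
  have vm [measurable]: "v j \<in> borel_measurable borel" for j using v by (auto simp: W_def)
  have wm [measurable]: "w \<in> borel_measurable borel"
    by (rule borel_measurable_LIMSEQ_real[OF lim]) simp_all
  have w01: "0 \<le> w x" "w x \<le> d" for x
    using v by (auto intro!: LIMSEQ_le_const[OF lim] LIMSEQ_le_const2[OF lim] simp: W_def)
  have w0: "w x = 0" if "x \<notin> \<Omega>" for x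
    using lim[of x] v that by (simp add: W_def LIMSEQ_const_iff)
  obtain K where K: "K \<ge> 0" "\<And>t. 0 \<le> t \<Longrightarrow> t \<le> d \<Longrightarrow> \<bar>primF h t\<bar> \<le> K"
    using primF_bounded[OF h] by blast
  have limF: "(\<lambda>j. primF h (v j x)) \<longlonglongrightarrow> primF h (w x)" for x
    by (rule continuous_on_tendsto_compose[OF continuous_primF[OF h] lim])
       (use w01 v in \<open>auto simp: W_def\<close>)
  have limI: "(\<lambda>j. \<integral>x. primF h (v j x) \<partial>lborel) \<longlonglongrightarrow> (\<integral>x. primF h (w x) \<partial>lborel)"
  proof (rule integral_dominated_convergence[where w="\<lambda>x. K * indicat_real \<Omega> x"])
    show "integrable lborel (\<lambda>x. K * indicat_real \<Omega> x)" using integrable_indicator_dom by simp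
    show "(\<lambda>x. primF h (w x)) \<in> borel_measurable lborel"
      by (rule borel_measurable_LIMSEQ_real[OF limF]) (use primF_measurable[OF h v] in simp)
    show "(\<lambda>x. primF h (v j x)) \<in> borel_measurable lborel" for j
      using primF_measurable[OF h v] by simp
  qed (use limF norm_primF_le[OF v K(2)] in auto)
  define I where "I = (\<integral>x. primF h (w x) \<partial>lborel)"
  define Q where "Q u = integral\<^sup>L (lborel \<Otimes>\<^sub>M lborel) (gagliardo s u)" for u :: "'a \<Rightarrow> real"
  have Qv: "(\<integral>\<^sup>+z. ennreal (gagliardo s (v j) z) \<partial>(lborel \<Otimes>\<^sub>M lborel)) = ennreal (Q (v j))" for j
    unfolding Q_def using v by (intro nn_integral_eq_integral) (auto simp: W_def)
  \<comment> \<open>The slack \<open>e\<close> absorbs the difference between the potential of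
    \<open>v j\<close> and its limit \<open>I\<close> for large \<open>j\<close>; it is sent to 0 at
    the end.\<close>
  have key: "(\<integral>\<^sup>+z. ennreal (gagliardo s w z) \<partial>(lborel \<Otimes>\<^sub>M lborel)) \<le> ennreal ((C + I + e) / \<kappa>)" if e: "e > 0" for e
  proof -
    have "\<forall>\<^sub>F j in sequentially. (\<integral>x. primF h (v j x) \<partial>lborel) < I + e"
      using order_tendstoD(2)[OF limI, of "I + e"] e by (simp add: I_def)
    then have ev: "\<forall>\<^sub>F j in sequentially. ennreal (Q (v j)) \<le> ennreal ((C + I + e) / \<kappa>)"
    proof eventually_elim
      case (elim j)
      have "\<kappa> * Q (v j) \<le> C + I + e" using le[of j] elim by (simp add: energy_def Q_def)
      then show ?case using kappa_pos by (intro ennreal_leI) (simp add: field_simps)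
    qed
    have "(\<lambda>j. gagliardo s (v j) z) \<longlonglongrightarrow> gagliardo s w z" for z
      unfolding gagliardo_def case_prod_unfold by (intro tendsto_intros lim)
    then have "(\<lambda>j. ennreal (gagliardo s (v j) z)) \<longlonglongrightarrow> ennreal (gagliardo s w z)" for z
      by (rule tendsto_ennrealI)
    then have "liminf (\<lambda>j. ennreal (gagliardo s (v j) z)) = ennreal (gagliardo s w z)" for z
      by (intro lim_imp_Liminf) simp_all
    then have "(\<integral>\<^sup>+z. ennreal (gagliardo s w z) \<partial>(lborel \<Otimes>\<^sub>M lborel)) \<le> liminf (\<lambda>j. \<integral>\<^sup>+z. ennreal (gagliardo s (v j) z) \<partial>(lborel \<Otimes>\<^sub>M lborel))"
      using nn_integral_liminf[of "\<lambda>j z. ennreal (gagliardo s (v j) z)" "lborel \<Otimes>\<^sub>M lborel"] by simp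
    also have "\<dots> \<le> liminf (\<lambda>j. ennreal ((C + I + e) / \<kappa>))"
      unfolding Qv by (rule Liminf_mono[OF ev])
    also have "\<dots> = ennreal ((C + I + e) / \<kappa>)" by (simp add: Liminf_const)
    finally show ?thesis .
  qed
  have iw: "integrable (lborel \<Otimes>\<^sub>M lborel) (gagliardo s w)"
    using key[of 1] by (auto simp: integrable_iff_bounded intro: le_less_trans)
  show "w \<in> W d" using w01 w0 iw by (simp add: W_def)
  have Qw: "(\<integral>\<^sup>+z. ennreal (gagliardo s w z) \<partial>(lborel \<Otimes>\<^sub>M lborel)) = ennreal (Q w)"
    unfolding Q_def by (rule nn_integral_eq_integral[OF iw]) auto
  have "energy h w \<le> C + e" if e: "e > 0" for e
  proof -
    \<comment> \<open>\<open>ennreal\<close> sends negative reals to 0, so the sign has to be known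
      before the bound in \<open>key\<close> can be read as an inequality between reals.\<close>
    have "0 \<le> C + I + e"
    proof -
      have "\<forall>\<^sub>F j in sequentially. (\<integral>x. primF h (v j x) \<partial>lborel) < I + e"
        using order_tendstoD(2)[OF limI, of "I + e"] e by (simp add: I_def)
      then obtain j where j: "(\<integral>x. primF h (v j x) \<partial>lborel) < I + e"
        by (auto dest: eventually_happens)
      have "0 \<le> \<kappa> * Q (v j)" using kappa_pos by (simp add: Q_def)
      then show ?thesis using j le[of j] by (simp add: energy_def Q_def)
    qed
    then have "Q w \<le> (C + I + e) / \<kappa>" using key[OF e] kappa_pos by (simp add: Qw ennreal_le_iff)
    then have "\<kappa> * Q w \<le> C + I + e" using kappa_pos by (simp add: field_simps)
    then show ?thesis by (simp add: energy_def Q_def I_def)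
  qed
  then show "energy h w \<le> C" by (rule field_le_epsilon)
qed

lemma minimizer_exists:
  assumes h: "continuous_on {0..d} h" and d: "d \<ge> 0"
  obtains w where "w \<in> W d" "energy h w = ground h d"
proof -
  define m where "m = ground h d"
  have "\<exists>u\<in>W d. energy h u < m + (1/2)^n" for n :: nat
    using cINF_less_iff[OF _ energy_bdd_below[OF h], of "m + (1/2)^n"] zero_in_W[OF d]
    by (auto simp: m_def ground_def)
  then obtain u where u: "\<And>n. u n \<in> W d" "\<And>n. energy h (u n) < m + (1/2)^n" by metis
  \<comment> \<open>\<open>M n j\<close> is the pointwise maximum of \<open>u n, \<dots>, u (n + j)\<close>.\<close>
  define M where "M n = rec_nat (u n) (\<lambda>j v x. max (v x) (u (n + Suc j) x))" for n
  have M0: "M n 0 = u n" and MS: "M n (Suc j) = (\<lambda>x. max (M n j x) (u (n + Suc j) x))" for n j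
    by (simp_all add: M_def)
  have MW: "M n j \<in> W d" for n j
    by (induction j) (simp_all add: M0 MS u(1) W_max_min(1) del: add_Suc_right)
  \<comment> \<open>The minimum in the submodular inequality has energy at least \<open>m\<close>,
    so each new function raises the energy of the maximum by at most its own defect. The defects
    from \<open>n\<close> to \<open>n + j\<close> sum to
    \<open>(1/2)^n * (2 - (1/2)^j)\<close>.\<close>
  have ME: "energy h (M n j) \<le> m + (1/2)^n * (2 - (1/2)^j)" for n j
  proof (induction j)
    case 0
    then show ?case using u(2)[of n] by (simp add: M0)
  next
    case (Suc j)
    let ?v = "u (n + Suc j)"
    have "m \<le> energy h (\<lambda>x. min (M n j x) (?v x))"
      unfolding m_def by (rule ground_le[OF h W_max_min(2)[OF MW u(1)]])
    then have "energy h (M n (Suc j)) \<le> energy h (M n j) + energy h ?v - m"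
      using W_max_min(3)[OF MW[of n j] u(1)[of "n + Suc j"] h] by (simp add: MS)
    also have "\<dots> \<le> m + (1/2)^n * (2 - (1/2)^j) + (1/2)^(n + Suc j)"
      using Suc u(2)[of "n + Suc j"] by simp
    also have "\<dots> = m + (1/2)^n * (2 - (1/2)^Suc j)"
      by (simp add: power_add algebra_simps)
    finally show ?case .
  qed
  have ME': "energy h (M n j) \<le> m + 2 * (1/2)^n" for n j
  proof -
    have "(1/2)^n * (2 - (1/2)^j) \<le> (1/2)^n * (2::real)" by (intro mult_left_mono) auto
    then show ?thesis using ME[of n j] by linarith
  qed
  have bdd: "bdd_above (range (\<lambda>j. M n j x))" for n x
    using MW by (intro bdd_aboveI[of _ d]) (auto simp: W_def)
  have inc: "incseq (\<lambda>j. M n j x)" for n x by (auto simp: incseq_Suc_iff MS)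
  \<comment> \<open>The supremum of the tail starting at \<open>n\<close>. The infimum of these
    tails, \<open>w\<close>, is the pointwise upper limit, reached by an increasing limit followed
    by a decreasing one; \<open>energy_lsc\<close> is applied to each.\<close>
  define v where "v n x = (SUP j. M n j x)" for n x
  have vlim: "(\<lambda>j. M n j x) \<longlonglongrightarrow> v n x" for n x
    unfolding v_def by (rule LIMSEQ_incseq_SUP[OF bdd inc])
  have vW: "v n \<in> W d" "energy h (v n) \<le> m + 2 * (1/2)^n" for n
    using energy_lsc[OF h MW vlim ME'] by auto
  have shift: "M (Suc n) j x \<le> M n (Suc j) x" for n j x
  proof (induction j)
    case 0
    then show ?case using MS[of n 0] by (simp add: M0)
  next
    case (Suc j)
    have "M (Suc n) (Suc j) x = max (M (Suc n) j x) (u (n + Suc (Suc j)) x)"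
      using MS[of "Suc n" j] by simp
    moreover have "M n (Suc (Suc j)) x = max (M n (Suc j) x) (u (n + Suc (Suc j)) x)"
      using MS[of n "Suc j"] by simp
    ultimately show ?case using Suc by (simp only: max.mono order_refl)
  qed
  have vdec: "decseq (\<lambda>n. v n x)" for x
  proof (rule decseq_SucI)
    fix n
    show "v (Suc n) x \<le> v n x"
      unfolding v_def[of "Suc n"]
      by (rule cSUP_least) (auto intro: order_trans[OF shift] simp: v_def intro!: cSUP_upper[OF _ bdd])
  qed
  define w where "w x = (INF n. v n x)" for x
  have "bdd_below (range (\<lambda>n. v n x))" for x
    using vW by (intro bdd_belowI[of _ 0]) (auto simp: W_def)
  then have wlim: "(\<lambda>n. v n x) \<longlonglongrightarrow> w x" for x
    unfolding w_def by (rule LIMSEQ_decseq_INF[OF _ vdec])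
  have *: "w \<in> W d \<and> energy h w \<le> m + 2 * (1/2)^N" for N
  proof -
    have "energy h (v (j + N)) \<le> m + 2 * (1/2)^N" for j
    proof -
      have "(1/2)^(j+N) \<le> (1/2::real)^N" by (intro power_decreasing) auto
      then show ?thesis using vW(2)[of "j + N"] by linarith
    qed
    moreover have "(\<lambda>j. v (j + N) x) \<longlonglongrightarrow> w x" for x using wlim by (rule LIMSEQ_ignore_initial_segment)
    ultimately show ?thesis using energy_lsc[OF h, of "\<lambda>j. v (j + N)" w] vW(1) by blast
  qed
  have "(\<lambda>N. m + 2 * (1/2)^N) \<longlonglongrightarrow> m + 2 * (0::real)"
    by (intro tendsto_intros LIMSEQ_power_zero) simp
  then have "energy h w \<le> m" using * by (intro LIMSEQ_le_const) auto
  moreover have "m \<le> energy h w" using * ground_le[OF h] by (simp add: m_def)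
  ultimately show ?thesis using that[of w] * by (simp add: m_def)
qed

section \<open>Minimisers are weak solutions\<close>

text \<open>On a domain of finite measure square integrability gives integrability, via |v| \<le> 1
  + v^2 there. This supplies the majorants for the Lipschitz primitive.\<close>

lemma X0_integrable:
  assumes "v \<in> X0 s \<Omega>"
  shows "integrable lborel v"
proof -
  have v: "v \<in> borel_measurable borel" "integrable lborel (\<lambda>x. (v x)\<^sup>2)" "AE x in lborel. x \<notin> \<Omega> \<longrightarrow> v x = 0"
    using assms by (auto simp: X0_iff)
  show ?thesis
  proof (rule Bochner_Integration.integrable_bound[OF Bochner_Integration.integrable_add[OF integrable_indicator_dom v(2)]])
    show "AE x in lborel. norm (v x) \<le> norm (indicat_real \<Omega> x + (v x)\<^sup>2)"
      using v(3)
    proof eventually_elim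
      case (elim x)
      have "\<bar>v x\<bar> \<le> 1 + (v x)\<^sup>2" using abs_mult_le_squares[of 1 "v x"] by simp
      then show ?case using elim by (auto simp: indicator_def)
    qed
  qed (use v in auto)
qed

lemma W_subset_X0: "W d \<subseteq> X0 s \<Omega>"
proof
  fix u assume u: "u \<in> W d"
  then have [measurable]: "u \<in> borel_measurable borel" by (simp add: W_def)
  have "integrable lborel (\<lambda>x. d\<^sup>2 * indicat_real \<Omega> x)" using integrable_indicator_dom by simp
  then have "integrable lborel (\<lambda>x. (u x)\<^sup>2)"
    by (rule Bochner_Integration.integrable_bound)
       (use u in \<open>auto intro!: AE_I2 power_mono simp: W_def indicator_def\<close>)
  then show "u \<in> X0 s \<Omega>" using u by (auto simp: W_def X0_iff)
qed

lemma truncate_in_W: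
  assumes v: "v \<in> X0 s \<Omega>" and d: "d > 0"
  obtains v' where "v' \<in> W d" "AE x in lborel. v' x = max 0 (min d (v x))"
    "integral\<^sup>L (lborel \<Otimes>\<^sub>M lborel) (gagliardo s v') \<le> integral\<^sup>L (lborel \<Otimes>\<^sub>M lborel) (gagliardo s v)"
proof -
  \<comment> \<open>A function in \<open>X0 s \<Omega>\<close> vanishes outside the domain only
    almost everywhere, so the representative is corrected there.\<close>
  define v' where "v' x = (if x \<in> \<Omega> then max 0 (min d (v x)) else 0)" for x
  have [measurable]: "v \<in> borel_measurable borel" and gv: "integrable (lborel \<Otimes>\<^sub>M lborel) (gagliardo s v)"
    and v0: "AE x in lborel. x \<notin> \<Omega> \<longrightarrow> v x = 0"
    using v by (auto simp: X0_iff)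
  have v'm [measurable]: "v' \<in> borel_measurable borel" unfolding v'_def by measurable
  have eq: "AE x in lborel. v' x = max 0 (min d (v x))"
    using v0 by eventually_elim (use d in \<open>auto simp: v'_def\<close>)
  have clamp: "\<bar>max 0 (min d a) - max 0 (min d b)\<bar> \<le> \<bar>a - b\<bar>" for a b :: real
    by (auto simp: max_def min_def)
  have le: "AE z in lborel \<Otimes>\<^sub>M lborel. gagliardo s v' z \<le> gagliardo s v z"
    using AE_lborel_pair[OF eq] by eventually_elim (auto intro!: gagliardo_mono clamp)
  have gv': "integrable (lborel \<Otimes>\<^sub>M lborel) (gagliardo s v')"
    by (rule Bochner_Integration.integrable_bound[OF gv]) (use le in auto)
  have "v' \<in> W d" using gv' d v'm by (auto simp: W_def v'_def)
  then show ?thesis using eq integral_mono_AE[OF gv' gv le] by (rule that)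
qed

lemma primF_trunc_integrable:
  assumes h: "continuous_on {0..d} h" "h 0 = 0" "d > 0" and v: "v \<in> X0 s \<Omega>"
  shows "integrable lborel (\<lambda>x. primF (trunc h d) (v x))"
proof -
  note [measurable] = primF_trunc_borel[OF h]
  have [measurable]: "v \<in> borel_measurable borel" using v by (simp add: X0_iff)
  obtain L where L: "L \<ge> 0" "\<And>t. \<bar>trunc h d t\<bar> \<le> L" using trunc_bounded[OF h] by blast
  have "integrable lborel (\<lambda>x. L * v x)" using X0_integrable[OF v] by simp
  then show ?thesis
    by (rule Bochner_Integration.integrable_bound)
       (use primF_trunc_lipschitz[OF h L(2), of _ 0] L(1) in \<open>auto simp: abs_mult\<close>)
qed

text \<open>Here \<open>v\<close> ranges over all of \<open>X0 s \<Omega>\<close>, so a minimiser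
  over the order interval can be varied in every direction, even where it touches 0 or
  \<open>d\<close>.\<close>

lemma ground_le_trunc:
  assumes h: "continuous_on {0..d} h" "h 0 = 0" "d > 0" and hd: "h d \<le> 0" and v: "v \<in> X0 s \<Omega>"
  shows "ground h d \<le> \<kappa> * integral\<^sup>L (lborel \<Otimes>\<^sub>M lborel) (gagliardo s v) - (\<integral>x. primF (trunc h d) (v x) \<partial>lborel)"
proof -
  obtain v' where v': "v' \<in> W d" "AE x in lborel. v' x = max 0 (min d (v x))"
    "integral\<^sup>L (lborel \<Otimes>\<^sub>M lborel) (gagliardo s v') \<le> integral\<^sup>L (lborel \<Otimes>\<^sub>M lborel) (gagliardo s v)"
    by (rule truncate_in_W[OF v h(3)])
  have "ground h d \<le> energy h v'" by (rule ground_le[OF h(1) v'(1)])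
  moreover have "(\<integral>x. primF (trunc h d) (v x) \<partial>lborel) \<le> (\<integral>x. primF h (v' x) \<partial>lborel)"
  proof (rule integral_mono_AE[OF primF_trunc_integrable[OF h v] primF_integrable[OF h(1) v'(1)]])
    show "AE x in lborel. primF (trunc h d) (v x) \<le> primF h (v' x)"
      using v'(2) by eventually_elim (simp add: primF_trunc_le[OF h hd])
  qed
  moreover have "\<kappa> * integral\<^sup>L (lborel \<Otimes>\<^sub>M lborel) (gagliardo s v') \<le> \<kappa> * integral\<^sup>L (lborel \<Otimes>\<^sub>M lborel) (gagliardo s v)"
    using v'(3) kappa_pos by simp
  ultimately show ?thesis by (simp add: energy_def)
qed

lemma trunc_mult_integrable:
  assumes h: "continuous_on {0..d} h" "h 0 = 0" "d > 0"
    and w: "w \<in> X0 s \<Omega>" and \<phi>: "\<phi> \<in> X0 s \<Omega>"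
  shows "integrable lborel (\<lambda>x. trunc h d (w x) * \<phi> x)"
proof -
  note [measurable] = trunc_borel[OF h]
  have [measurable]: "w \<in> borel_measurable borel" "\<phi> \<in> borel_measurable borel" using w \<phi> by (auto simp: X0_iff)
  obtain L where L: "L \<ge> 0" "\<And>t. \<bar>trunc h d t\<bar> \<le> L" using trunc_bounded[OF h] by blast
  have "integrable lborel (\<lambda>x. L * \<phi> x)" using X0_integrable[OF \<phi>] by simp
  then show ?thesis
    by (rule Bochner_Integration.integrable_bound)
       (use L in \<open>auto simp: abs_mult intro!: AE_I2 mult_right_mono\<close>)
qed

text \<open>Comparing \<open>w\<close> with \<open>w + t * \<phi>\<close> for positive
  \<open>t\<close> only, dividing by \<open>t\<close> and letting it tend to 0 gives one inequality;
  the reverse one comes from \<open>- \<phi>\<close>.\<close>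

lemma minimizer_variation:
  assumes h: "continuous_on {0..d} h" "h 0 = 0" "d > 0" and hd: "h d \<le> 0"
    and w: "w \<in> W d" "energy h w = ground h d" and \<phi>: "\<phi> \<in> X0 s \<Omega>"
  shows "(\<integral>x. trunc h d (w x) * \<phi> x \<partial>lborel) \<le> 2 * \<kappa> * integral\<^sup>L (lborel \<Otimes>\<^sub>M lborel) (gcross s w \<phi>)"
proof -
  have wX: "w \<in> X0 s \<Omega>" using w W_subset_X0 by blast
  note [measurable] = primF_trunc_borel[OF h] trunc_borel[OF h]
  have [measurable]: "w \<in> borel_measurable borel" "\<phi> \<in> borel_measurable borel" using wX \<phi> by (auto simp: X0_iff)
  define B where "B = integral\<^sup>L (lborel \<Otimes>\<^sub>M lborel) (gcross s w \<phi>)"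
  define Q where "Q = integral\<^sup>L (lborel \<Otimes>\<^sub>M lborel) (gagliardo s \<phi>)"
  define t where "t n = 1 / real (Suc n)" for n
  define D where "D n x = (primF (trunc h d) (w x + t n * \<phi> x) - primF (trunc h d) (w x)) / t n" for n x
  have t: "t n > 0" for n by (simp add: t_def)
  have tlim: "t \<longlonglongrightarrow> 0" unfolding t_def by (rule lim_1_over_n[THEN LIMSEQ_Suc])
  obtain L where L: "L \<ge> 0" "\<And>t. \<bar>trunc h d t\<bar> \<le> L" using trunc_bounded[OF h] by blast
  have wF: "(\<integral>x. primF (trunc h d) (w x) \<partial>lborel) = (\<integral>x. primF h (w x) \<partial>lborel)"
    using w(1) by (intro Bochner_Integration.integral_cong primF_trunc_eq[OF h]) (auto simp: W_def)
  have ineq: "(\<integral>x. D n x \<partial>lborel) \<le> \<kappa> * (2 * B + t n * Q)" for n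
  proof -
    note wt = X0_add[OF wX \<phi>, of "t n"]
    have iw: "integrable lborel (\<lambda>x. primF (trunc h d) (w x))" 
     and iv: "integrable lborel (\<lambda>x. primF (trunc h d) (w x + t n * \<phi> x))"
      using primF_trunc_integrable[OF h wX] primF_trunc_integrable[OF h wt(1)] by auto
    have "(\<integral>x. primF (trunc h d) (w x + t n * \<phi> x) \<partial>lborel) - (\<integral>x. primF (trunc h d) (w x) \<partial>lborel)
       \<le> \<kappa> * (2 * t n * B + (t n)\<^sup>2 * Q)"
      using ground_le_trunc[OF h hd wt(1)] w(2)
      unfolding wt(2) energy_def wF B_def Q_def by (simp add: algebra_simps)
    also have "\<dots> = t n * (\<kappa> * (2 * B + t n * Q))" by (simp add: power2_eq_square algebra_simps)
    finally have "((\<integral>x. primF (trunc h d) (w x + t n * \<phi> x) \<partial>lborel) - (\<integral>x. primF (trunc h d) (w x) \<partial>lborel)) / t n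
       \<le> \<kappa> * (2 * B + t n * Q)"
      using t[of n] by (simp add: divide_le_eq mult.commute)
    then show ?thesis
      unfolding D_def by (simp add: Bochner_Integration.integral_diff[OF iv iw])
  qed
  have Dlim: "(\<lambda>n. D n x) \<longlonglongrightarrow> trunc h d (w x) * \<phi> x" for x
  proof -
    have "((\<lambda>r. primF (trunc h d) (w x + r * \<phi> x)) has_real_derivative trunc h d (w x + 0 * \<phi> x) * \<phi> x) (at 0)"
      by (rule DERIV_chain2[OF primF_trunc_deriv[OF h]]) (auto intro!: derivative_eq_intros)
    then have "((\<lambda>r. (primF (trunc h d) (w x + r * \<phi> x) - primF (trunc h d) (w x)) / r) \<longlongrightarrow> trunc h d (w x) * \<phi> x) (at 0)"
      by (simp add: DERIV_def)
    moreover have "filterlim t (at 0) sequentially"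
      using tlim t by (intro filterlim_atI) (auto intro!: always_eventually less_imp_neq[symmetric])
    ultimately show ?thesis unfolding D_def by (rule filterlim_compose)
  qed
  have "(\<lambda>n. \<integral>x. D n x \<partial>lborel) \<longlonglongrightarrow> (\<integral>x. trunc h d (w x) * \<phi> x \<partial>lborel)"
  proof (rule integral_dominated_convergence[where w="\<lambda>x. L * \<bar>\<phi> x\<bar>"])
    show "integrable lborel (\<lambda>x. L * \<bar>\<phi> x\<bar>)" using X0_integrable[OF \<phi>] by simp
    show "AE x in lborel. norm (D n x) \<le> L * \<bar>\<phi> x\<bar>" for n
    proof (rule AE_I2)
      fix x
      have "\<bar>primF (trunc h d) (w x + t n * \<phi> x) - primF (trunc h d) (w x)\<bar> \<le> L * \<bar>t n * \<phi> x\<bar>"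
        using primF_trunc_lipschitz[OF h L(2), of "w x + t n * \<phi> x" "w x"] by simp
      then show "norm (D n x) \<le> L * \<bar>\<phi> x\<bar>"
        using t[of n] by (simp add: D_def abs_mult field_simps)
    qed
  qed (use Dlim in \<open>auto simp: D_def\<close>)
  moreover have "(\<lambda>n. \<kappa> * (2 * B + t n * Q)) \<longlonglongrightarrow> \<kappa> * (2 * B + 0 * Q)"
    by (intro tendsto_intros tlim)
  ultimately have "(\<integral>x. trunc h d (w x) * \<phi> x \<partial>lborel) \<le> \<kappa> * (2 * B + 0 * Q)"
    by (rule LIMSEQ_le) (use ineq in auto)
  then show ?thesis by (simp add: B_def mult_ac)
qed

text \<open>The quarter in \<open>\<kappa>\<close> is forced: varying the quadratic term produces
  \<open>2 * \<kappa>\<close> times the bilinear form, and the weak formulation carries half of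
  \<open>frac_const\<close>.\<close>

lemma minimizer_weak_solution:
  assumes kap: "\<kappa> = frac_const s TYPE('a) / 4"
    and h: "continuous_on {0..d} h" "h 0 = 0" "d > 0" and hd: "h d \<le> 0"
    and w: "w \<in> W d" "energy h w = ground h d"
  shows "weak_solution s \<Omega> (\<lambda>t. if t > 0 then h t else 0) w"
proof -
  have wX: "w \<in> X0 s \<Omega>" using w W_subset_X0 by blast
  \<comment> \<open>Since \<open>w\<close> takes values in [0,d], the freezing is invisible along
    it.\<close>
  have hw: "(if w x > 0 then h (w x) else 0) = trunc h d (w x)" for x
    using w(1) h(2) by (auto simp: trunc_def W_def not_less dest: antisym[of "w x" 0] intro!: arg_cong[of _ _ h])
  show ?thesis
    unfolding weak_solution_def hw
  proof (intro conjI wX ballI)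
    fix \<phi> assume \<phi>: "\<phi> \<in> X0 s \<Omega>"
    have g: "(\<lambda>(x, y). (w x - w y) * (\<phi> x - \<phi> y) * gkernel s x y) = gcross s w \<phi>"
      by (simp add: gcross_def)
    show "integrable (lborel \<Otimes>\<^sub>M lborel) (\<lambda>(x, y). (w x - w y) * (\<phi> x - \<phi> y) * gkernel s x y)"
      unfolding g using wX \<phi> by (intro integrable_gcross) (auto simp: X0_iff)
    show "integrable lborel (\<lambda>x. trunc h d (w x) * \<phi> x)"
      by (rule trunc_mult_integrable[OF h wX \<phi>])
    \<comment> \<open>Obtained as \<open>\<phi> + (-2) * \<phi>\<close> from closure under linear
      combinations.\<close>
    have m: "(\<lambda>x. - \<phi> x) \<in> X0 s \<Omega>"
      using X0_add(1)[OF \<phi> \<phi>, of "-2"] by simp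
    have "gcross s w (\<lambda>x. - \<phi> x) = (\<lambda>z. - gcross s w \<phi> z)"
      by (auto simp: gcross_def fun_eq_iff algebra_simps)
    then have "- (\<integral>x. trunc h d (w x) * \<phi> x \<partial>lborel) \<le> - (2 * \<kappa> * integral\<^sup>L (lborel \<Otimes>\<^sub>M lborel) (gcross s w \<phi>))"
      using minimizer_variation[OF h hd w m] by simp
    then have "2 * \<kappa> * integral\<^sup>L (lborel \<Otimes>\<^sub>M lborel) (gcross s w \<phi>) = (\<integral>x. trunc h d (w x) * \<phi> x \<partial>lborel)"
      using minimizer_variation[OF h hd w \<phi>] by simp
    then show "frac_const s TYPE('a) / 2 * (\<integral>z. (case z of (x, y) \<Rightarrow> (w x - w y) * (\<phi> x - \<phi> y) * gkernel s x y) \<partial>(lborel \<Otimes>\<^sub>M lborel))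
       = (\<integral>x. trunc h d (w x) * \<phi> x \<partial>lborel)"
      unfolding g kap by simp
  qed
qed

section \<open>Infinitely many negative energy levels\<close>

text \<open>The upper limit condition on F only gives information at isolated heights T, so a test
  function must equal T on a set of positive measure. Hence the plateau \<open>B\<close>.\<close>

lemma cutoff_exists:
  obtains \<phi> B where "\<phi> \<in> W 1" "B \<in> sets borel" "B \<subseteq> \<Omega>" "measure lborel B > 0" "\<And>x. x \<in> B \<Longrightarrow> \<phi> x = 1"
proof -
  obtain x0 where "x0 \<in> \<Omega>" using nonempty_dom by blast
  then obtain R where R: "R > 0" "cball x0 R \<subseteq> \<Omega>" using open_dom open_contains_cball by blast
  define r where "r = R / 2"
  have r: "r > 0" "cball x0 (2 * r) \<subseteq> \<Omega>" using R by (auto simp: r_def)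
  define \<phi> where "\<phi> x = max 0 (min 1 (2 - dist x0 x / r))" for x
  have [measurable]: "\<phi> \<in> borel_measurable borel" unfolding \<phi>_def by measurable
  have off: "\<phi> x = 0" if "x \<notin> cball x0 (2 * r)" for x
    using that r by (simp add: \<phi>_def field_simps)
  \<comment> \<open>The slope of the cutoff is 1/r and its oscillation is at most 1; the sum of the
    two squared constants serves both branches of the minimum.\<close>
  have lip: "(\<phi> x - \<phi> y)\<^sup>2 \<le> (1 + 1 / r\<^sup>2) * min 1 ((norm (x - y))\<^sup>2)" for x y
  proof -
    have "\<bar>\<phi> x - \<phi> y\<bar> \<le> \<bar>dist x0 x / r - dist x0 y / r\<bar>" by (auto simp: \<phi>_def max_def min_def)
    also have "\<dots> = \<bar>dist x0 x - dist x0 y\<bar> / r" using r by (simp flip: diff_divide_distrib)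
    also have "\<dots> \<le> norm (x - y) / r"
      using r abs_dist_diff_le[of x x0 y] by (intro divide_right_mono) (auto simp: dist_norm norm_minus_commute)
    finally have "\<bar>\<phi> x - \<phi> y\<bar>\<^sup>2 \<le> (norm (x - y) / r)\<^sup>2" by (intro power_mono) auto
    then have 1: "(\<phi> x - \<phi> y)\<^sup>2 \<le> 1 / r\<^sup>2 * (norm (x - y))\<^sup>2" by (simp add: power_divide)
    have "\<bar>\<phi> x - \<phi> y\<bar> \<le> 1" by (auto simp: \<phi>_def max_def min_def)
    then have 2: "(\<phi> x - \<phi> y)\<^sup>2 \<le> 1" by (simp add: abs_square_le_1)
    show ?thesis
    proof (cases "(norm (x - y))\<^sup>2 \<le> 1")
      case True
      then show ?thesis using 1 by (simp add: min_def distrib_right add_increasing)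
    next
      case False
      then show ?thesis using 2 by (simp add: min_def add_increasing2)
    qed
  qed
  have "integrable (lborel \<Otimes>\<^sub>M lborel) (gagliardo s \<phi>)"
  proof (rule lipschitz_gagliardo_integrable[OF s_pos s_less])
    show "emeasure lborel (cball x0 (2 * r)) < \<infinity>" by (rule emeasure_bounded_finite) simp
  qed (use off lip in auto)
  moreover have "\<phi> x = 0" if "x \<notin> \<Omega>" for x using off r(2) that by blast
  moreover have "0 \<le> \<phi> x \<and> \<phi> x \<le> 1" for x by (simp add: \<phi>_def)
  ultimately have "\<phi> \<in> W 1" by (simp add: W_def)
  moreover have "measure lborel (cball x0 r) > 0"
    using r content_cball_pos by blast
  moreover have "\<phi> x = 1" if "x \<in> cball x0 r" for x
    using that r by (simp add: \<phi>_def field_simps)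
  moreover have "cball x0 r \<subseteq> \<Omega>" using r by (auto simp: subset_iff)
  ultimately show ?thesis using that[of \<phi> "cball x0 r"] by auto
qed

lemma W_scale:
  assumes "\<phi> \<in> W 1" "0 \<le> T" "T \<le> d"
  shows "(\<lambda>x. T * \<phi> x) \<in> W d"
proof -
  have "T * \<phi> x \<le> T" for x
    using assms mult_left_mono[of "\<phi> x" 1 T] by (simp add: W_def)
  then have "T * \<phi> x \<le> d" for x
    using assms(3) by (rule order_trans)
  then show ?thesis using assms by (auto simp: W_def gagliardo_scale)
qed

text \<open>The competitor is \<open>T * \<phi>\<close>: it gains F(T) on the plateau, and elsewhere
  only the quadratic lower bound on F is available. The constant \<open>C\<close> covers bounded
  arguments in the regime at infinity; near 0 it is taken to be 0.\<close>

lemma ground_test: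
  assumes h: "continuous_on {0..d} h" and T: "0 \<le> T" "T \<le> d"
    and \<phi>: "\<phi> \<in> W 1" "B \<in> sets borel" "B \<subseteq> \<Omega>" "\<And>x. x \<in> B \<Longrightarrow> \<phi> x = 1"
    and low: "\<And>t. 0 \<le> t \<Longrightarrow> t \<le> T \<Longrightarrow> primF h t \<ge> - (l * t\<^sup>2) - C" and lC: "l \<ge> 0" "C \<ge> 0"
  shows "ground h d \<le> T\<^sup>2 * (\<kappa> * integral\<^sup>L (lborel \<Otimes>\<^sub>M lborel) (gagliardo s \<phi>) + l * measure lborel \<Omega>)
      + C * measure lborel \<Omega> - measure lborel B * primF h T"
proof -
  let ?v = "\<lambda>x. T * \<phi> x"
  have vW: "?v \<in> W d" by (rule W_scale[OF \<phi>(1) T])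
  have fB: "emeasure lborel B < \<infinity>"
    using emeasure_mono[OF \<phi>(3), of lborel] dom_finite by simp
  have iB: "integrable lborel (indicat_real B)" using fB \<phi>(2) by (intro integrable_real_indicator) auto
  have "measure lborel B * primF h T - (l * T\<^sup>2 + C) * measure lborel \<Omega>
     = (\<integral>x. primF h T * indicat_real B x - (l * T\<^sup>2 + C) * indicat_real \<Omega> x \<partial>lborel)"
    using iB integrable_indicator_dom by simp
  also have "\<dots> \<le> (\<integral>x. primF h (?v x) \<partial>lborel)"
  proof (rule integral_mono)
    show "integrable lborel (\<lambda>x. primF h T * indicat_real B x - (l * T\<^sup>2 + C) * indicat_real \<Omega> x)"
      using iB integrable_indicator_dom by simp
    show "integrable lborel (\<lambda>x. primF h (?v x))" by (rule primF_integrable[OF h vW])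
    fix x
    have p: "l * T\<^sup>2 + C \<ge> 0" using lC by simp
    consider "x \<in> B" | "x \<in> \<Omega>" "x \<notin> B" | "x \<notin> \<Omega>" by blast
    then show "primF h T * indicat_real B x - (l * T\<^sup>2 + C) * indicat_real \<Omega> x \<le> primF h (?v x)"
    proof cases
      case 1
      then show ?thesis using \<phi>(3,4) p by (auto simp: indicator_def)
    next
      case 2
      have v: "0 \<le> ?v x" "?v x \<le> T" using W_scale[OF \<phi>(1) T(1) order_refl] by (auto simp: W_def)
      have "(?v x)\<^sup>2 \<le> T\<^sup>2" using v by (intro power_mono)
      then have "l * (?v x)\<^sup>2 \<le> l * T\<^sup>2" using lC by (intro mult_left_mono)
      then show ?thesis using low[OF v] 2 by simp
    next
      case 3
      then have "\<phi> x = 0" "x \<notin> B" using \<phi>(1,3) by (auto simp: W_def)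
      then show ?thesis using 3 by simp
    qed
  qed
  finally have "energy h ?v \<le> \<kappa> * (T\<^sup>2 * integral\<^sup>L (lborel \<Otimes>\<^sub>M lborel) (gagliardo s \<phi>))
      - (measure lborel B * primF h T - (l * T\<^sup>2 + C) * measure lborel \<Omega>)"
    by (simp add: energy_def gagliardo_scale)
  then show ?thesis
    using ground_le[OF h vW] by (simp add: algebra_simps)
qed

text \<open>A set of energies rather than of endpoints \<open>d\<close>, since distinct energies
  force distinct minimisers. Negativity excludes the zero function, and \<open>h d\<close> < 0 is
  strict so as to be stable under perturbation.\<close>

definition negative_levels :: "(real \<Rightarrow> real) \<Rightarrow> real set" where
  "negative_levels h = ground h ` {d. d > 0 \<and> h d < 0} \<inter> {..<0}"

text \<open>Every interval (-eps,0) contains a level. A small \<open>d\<close> bounds F, hence the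
  minimal energy from below, and a test height \<open>T\<close> < \<open>d\<close> makes that energy
  negative. A finite nonempty set of negative numbers could not come arbitrarily close to 0.\<close>

lemma infinite_levels_at_0:
  assumes h: "continuous_on {0..} h"
    and low: "\<forall>\<^sub>F t in at_right 0. primF h t \<ge> - (l * t\<^sup>2)"
    and high: "\<And>M. \<exists>\<^sub>F t in at_right 0. primF h t > M * t\<^sup>2"
    and neg: "\<exists>\<^sub>F t in at_right 0. h t < 0"
  shows "infinite (negative_levels h)"
proof -
  have hc: "continuous_on {0..d} h" for d by (rule continuous_on_subset[OF h]) auto
  define l' where "l' = max 0 l"
  have "\<exists>m\<in>negative_levels h. - \<epsilon> < m" if \<epsilon>: "\<epsilon> > 0" for \<epsilon>
  proof -
    define \<epsilon>' where "\<epsilon>' = \<epsilon> / (measure lborel \<Omega> + 1)"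
    have e': "\<epsilon>' > 0" "\<epsilon>' * measure lborel \<Omega> < \<epsilon>"
      using \<epsilon> by (auto simp: \<epsilon>'_def field_simps add_pos_nonneg intro!: add_pos_nonneg)
    have "(primF h \<longlongrightarrow> primF h 0) (at 0 within {0..1})"
      using continuous_primF[OF hc, of 1, unfolded continuous_on_def, rule_format, of 0] by simp
    from tendstoD[OF this e'(1)] obtain d1 where "d1 > 0"
      and *: "\<forall>t\<in>{0..1}. t \<noteq> 0 \<and> dist t 0 < d1 \<longrightarrow> dist (primF h t) (primF h 0) < \<epsilon>'"
      unfolding eventually_at by blast
    have d1: "\<bar>primF h t\<bar> < \<epsilon>'" if "0 \<le> t" "t \<le> 1" "t < d1" for t
      using *[rule_format, of t] that e'(1) by (cases "t = 0") auto
    obtain d2 where d2: "d2 > 0" "\<And>t. 0 < t \<Longrightarrow> t < d2 \<Longrightarrow> primF h t \<ge> - (l * t\<^sup>2)"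
      using low by (auto simp: eventually_at_right_field)
    define d0 where "d0 = min 1 (min d1 d2)"
    have d0: "d0 > 0" "d0 \<le> 1" "d0 \<le> d1" "d0 \<le> d2" using \<open>d1 > 0\<close> d2 by (auto simp: d0_def)
    have "\<forall>\<^sub>F t in at_right 0. 0 < t \<and> t < d0"
      using d0 by (auto simp: eventually_at_right_field)
    from frequently_eventually_ex[OF neg this] obtain d where d: "h d < 0" "0 < d" "d < d0" by blast
    obtain \<phi> B where \<phi>: "\<phi> \<in> W 1" "B \<in> sets borel" "B \<subseteq> \<Omega>" "measure lborel B > 0" "\<And>x. x \<in> B \<Longrightarrow> \<phi> x = 1"
      by (rule cutoff_exists) blast
    \<comment> \<open>All costs that are quadratic in the height: the Gagliardo energy of the cutoff
      and the possible loss of potential. \<open>T\<close> is then chosen so that the gain on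
      \<open>B\<close> exceeds \<open>K * T\<^sup>2\<close>.\<close>
    define K where "K = \<kappa> * integral\<^sup>L (lborel \<Otimes>\<^sub>M lborel) (gagliardo s \<phi>) + l' * measure lborel \<Omega>"
    have "\<forall>\<^sub>F t in at_right 0. 0 < t \<and> t < d"
      using d by (auto simp: eventually_at_right_field)
    from frequently_eventually_ex[OF high[of "K / measure lborel B"] this]
    obtain T where T: "primF h T > K / measure lborel B * T\<^sup>2" "0 < T" "T < d" by blast
    have "ground h d \<le> T\<^sup>2 * K + 0 * measure lborel \<Omega> - measure lborel B * primF h T"
      unfolding K_def
    proof (rule ground_test[OF hc _ _ \<phi>(1,2,3,5)])
      fix t assume t: "0 \<le> t" "t \<le> T"
      show "- (l' * t\<^sup>2) - 0 \<le> primF h t"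
      proof (cases "t = 0")
        case False
        then have "- (l * t\<^sup>2) \<le> primF h t" using t T d d0 by (intro d2) auto
        moreover have "l * t\<^sup>2 \<le> l' * t\<^sup>2" by (intro mult_right_mono) (auto simp: l'_def)
        ultimately show ?thesis by linarith
      qed simp
    qed (use T in \<open>auto simp: l'_def\<close>)
    also have "\<dots> < 0" using T(1) \<phi>(4) by (simp add: field_simps)
    finally have n: "ground h d < 0" .
    have "\<bar>primF h t\<bar> \<le> \<epsilon>'" if "0 \<le> t" "t \<le> d" for t
      using d1[of t] that d d0 by auto
    from energy_ge[OF _ hc this] obtain w where "energy h w = ground h d" "- (\<epsilon>' * measure lborel \<Omega>) \<le> energy h w"
      using minimizer_exists[OF hc, of d] d by (metis less_imp_le)
    then have "- \<epsilon> < ground h d" using e' by linarith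
    then show ?thesis using n d by (auto simp: negative_levels_def)
  qed
  note * = this
  show ?thesis
  proof
    assume fin: "finite (negative_levels h)"
    moreover have ne: "negative_levels h \<noteq> {}" using *[of 1] by auto
    ultimately have "Max (negative_levels h) \<in> negative_levels h" by (rule Max_in)
    then have "Max (negative_levels h) < 0" by (simp add: negative_levels_def)
    then obtain m where "m \<in> negative_levels h" "Max (negative_levels h) < m"
      using *[of "- Max (negative_levels h)"] by auto
    then show False using Max_ge[OF fin, of m] by simp
  qed
qed

text \<open>Here the levels are unbounded below. The order of choice is the reverse of the one near
  0: first a height \<open>T\<close> with a large gain, then an admissible \<open>d\<close> beyond
  it.\<close>

lemma infinite_levels_at_top:
  assumes h: "continuous_on {0..} h"
    and low: "\<forall>\<^sub>F t in at_top. primF h t \<ge> - (l * t\<^sup>2)"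
    and high: "\<And>M. \<exists>\<^sub>F t in at_top. primF h t > M * t\<^sup>2"
    and neg: "\<exists>\<^sub>F t in at_top. h t < 0"
  shows "infinite (negative_levels h)"
proof -
  have hc: "continuous_on {0..d} h" for d by (rule continuous_on_subset[OF h]) auto
  define l' where "l' = max 0 l"
  obtain t0 where t0: "\<And>t. t \<ge> t0 \<Longrightarrow> primF h t \<ge> - (l * t\<^sup>2)"
    using low by (auto simp: eventually_at_top_linorder)
  obtain C where C: "C \<ge> 0" "\<And>t. 0 \<le> t \<Longrightarrow> t \<le> t0 \<Longrightarrow> \<bar>primF h t\<bar> \<le> C"
    using primF_bounded[OF hc] by blast
  \<comment> \<open>The quadratic bound holds only from \<open>t0\<close> on; \<open>C\<close>
    absorbs the compact interval before it.\<close>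
  have low': "- (l' * t\<^sup>2) - C \<le> primF h t" if t: "0 \<le> t" for t
  proof -
    have 1: "l * t\<^sup>2 \<le> l' * t\<^sup>2" by (intro mult_right_mono) (auto simp: l'_def)
    have 2: "0 \<le> l' * t\<^sup>2" by (simp add: l'_def)
    show ?thesis
      using t0[of t] C(1) C(2)[of t] t 1 2 by (cases "t \<le> t0") (auto simp: abs_le_iff)
  qed
  obtain \<phi> B where \<phi>: "\<phi> \<in> W 1" "B \<in> sets borel" "B \<subseteq> \<Omega>" "measure lborel B > 0" "\<And>x. x \<in> B \<Longrightarrow> \<phi> x = 1"
    by (rule cutoff_exists) blast
  define K where "K = \<kappa> * integral\<^sup>L (lborel \<Otimes>\<^sub>M lborel) (gagliardo s \<phi>) + l' * measure lborel \<Omega>"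
  have *: "\<exists>m\<in>negative_levels h. m < - N" if N: "N \<ge> 0" for N
  proof -
    \<comment> \<open>Using \<open>K + 1\<close> instead of \<open>K\<close> leaves a surplus of
      \<open>T\<^sup>2\<close> \<ge> \<open>R\<close>, which pays for the constant loss and pushes
      the energy below -N. Because \<open>R\<close> \<ge> 1, \<open>T\<close> > \<open>R\<close>
      already gives \<open>T\<^sup>2\<close> \<ge> \<open>R\<close>.\<close>
    define R where "R = C * measure lborel \<Omega> + N + 1"
    have R: "R \<ge> 1" using C N by (simp add: R_def)
    have "\<forall>\<^sub>F t in at_top. t > R" by (rule eventually_gt_at_top)
    from frequently_eventually_ex[OF high[of "(K + 1) / measure lborel B"] this]
    obtain T where T: "primF h T > (K + 1) / measure lborel B * T\<^sup>2" "T > R" by blast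
    from frequently_eventually_ex[OF neg eventually_gt_at_top[of T]]
    obtain d where d: "h d < 0" "d > T" by blast
    have "R * 1 \<le> T * T" using T R by (intro mult_mono) auto
    then have TT: "R \<le> T\<^sup>2" by (simp add: power2_eq_square)
    have "ground h d \<le> T\<^sup>2 * K + C * measure lborel \<Omega> - measure lborel B * primF h T"
      unfolding K_def
      by (rule ground_test[OF hc _ _ \<phi>(1,2,3,5)]) (use T R d C low' in \<open>auto simp: l'_def\<close>)
    moreover have "T\<^sup>2 * (K + 1) < measure lborel B * primF h T" using T(1) \<phi>(4) by (simp add: field_simps)
    ultimately have "ground h d < - N" using TT by (simp add: R_def algebra_simps)
    then show ?thesis using d T R N by (force simp: negative_levels_def)
  qed
  show ?thesis
  proof
    assume fin: "finite (negative_levels h)"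
    moreover have ne: "negative_levels h \<noteq> {}" using *[of 0] by auto
    ultimately have "Min (negative_levels h) \<in> negative_levels h" by (rule Min_in)
    then have "Min (negative_levels h) < 0" by (simp add: negative_levels_def)
    then obtain m where "m \<in> negative_levels h" "m < Min (negative_levels h)"
      using *[of "- Min (negative_levels h)"] by auto
    then show False using Min_le[OF fin, of m] by simp
  qed
qed

section \<open>Stability under perturbation\<close>

lemma energy_perturb:
  assumes h: "continuous_on {0..d} h" and e: "continuous_on {0..d} e"
    and C: "\<And>t. 0 \<le> t \<Longrightarrow> t \<le> d \<Longrightarrow> \<bar>primF e t\<bar> \<le> C" and u: "u \<in> W d"
  shows "\<bar>energy (\<lambda>r. h r + c * e r) u - energy h u\<bar> \<le> \<bar>c\<bar> * (C * measure lborel \<Omega>)"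
proof -
  have eq: "primF (\<lambda>r. h r + c * e r) (u x) = primF h (u x) + c * primF e (u x)" for x
    using u by (intro primF_add_scale continuous_on_subset[OF h] continuous_on_subset[OF e]) (auto simp: W_def)
  have "energy (\<lambda>r. h r + c * e r) u - energy h u = - c * (\<integral>x. primF e (u x) \<partial>lborel)"
    unfolding energy_def eq using primF_integrable[OF h u] primF_integrable[OF e u] by simp
  then show ?thesis
    using primF_integral_le[OF u e C] by (simp add: abs_mult mult_left_mono)
qed

text \<open>Testing each of the two problems with the minimiser of the other bounds the difference
  of the minimal energies by a multiple of |c|.\<close>

lemma ground_perturb:
  assumes h: "continuous_on {0..d} h" and e: "continuous_on {0..d} e" and d: "d \<ge> 0"
  shows "((\<lambda>c. ground (\<lambda>r. h r + c * e r) d) \<longlongrightarrow> ground h d) (nhds 0)"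
proof -
  obtain C where C: "C \<ge> 0" "\<And>t. 0 \<le> t \<Longrightarrow> t \<le> d \<Longrightarrow> \<bar>primF e t\<bar> \<le> C"
    using primF_bounded[OF e] by blast
  have le: "\<bar>ground (\<lambda>r. h r + c * e r) d - ground h d\<bar> \<le> \<bar>c\<bar> * (C * measure lborel \<Omega>)" for c
  proof -
    have hc: "continuous_on {0..d} (\<lambda>r. h r + c * e r)" by (intro continuous_intros h e)
    obtain w where w: "w \<in> W d" "energy h w = ground h d" using minimizer_exists[OF h d] by blast
    obtain v where v: "v \<in> W d" "energy (\<lambda>r. h r + c * e r) v = ground (\<lambda>r. h r + c * e r) d"
      using minimizer_exists[OF hc d] by blast
    show ?thesis
      using ground_le[OF h v(1)] ground_le[OF hc w(1)] w v
        energy_perturb[OF h e C(2) w(1), of c] energy_perturb[OF h e C(2) v(1), of c]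
      by (simp add: abs_le_iff)
  qed
  have "((\<lambda>c. \<bar>c\<bar> * (C * measure lborel \<Omega>)) \<longlongrightarrow> \<bar>0\<bar> * (C * measure lborel \<Omega>)) (nhds 0)"
    by (rule tendsto_mult[OF tendsto_rabs[OF filterlim_ident] tendsto_const])
  then have "((\<lambda>c. \<bar>c\<bar> * (C * measure lborel \<Omega>)) \<longlongrightarrow> 0) (nhds 0)" by simp
  then have "((\<lambda>c. ground (\<lambda>r. h r + c * e r) d - ground h d) \<longlongrightarrow> 0) (nhds 0)"
    by (rule Lim_null_comparison[rotated]) (intro always_eventually allI, unfold real_norm_def, rule le)
  then show ?thesis by (rule LIM_zero_cancel)
qed

text \<open>The two functions may come from different order intervals; contrapositively, different
  energies separate minimisers belonging to different endpoints.\<close>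

lemma energy_cong_AE:
  assumes u: "u \<in> W d" and v: "v \<in> W d'" and h: "continuous_on {0..} h"
    and eq: "AE x in lborel. u x = v x"
  shows "energy h u = energy h v"
proof -
  have [measurable]: "u \<in> borel_measurable borel" "v \<in> borel_measurable borel" using u v by (auto simp: W_def)
  have hc: "continuous_on {0..b} h" for b by (rule continuous_on_subset[OF h]) auto
  have "AE z in lborel \<Otimes>\<^sub>M lborel. gagliardo s u z = gagliardo s v z"
    using AE_lborel_pair[OF eq] by eventually_elim (simp add: gagliardo_def case_prod_unfold)
  then have "integral\<^sup>L (lborel \<Otimes>\<^sub>M lborel) (gagliardo s u) = integral\<^sup>L (lborel \<Otimes>\<^sub>M lborel) (gagliardo s v)"
    by (intro integral_cong_AE) auto
  moreover have "(\<integral>x. primF h (u x) \<partial>lborel) = (\<integral>x. primF h (v x) \<partial>lborel)"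
    using eq primF_measurable[OF hc u] primF_measurable[OF hc v]
    by (intro integral_cong_AE) (auto elim: eventually_mono)
  ultimately show ?thesis by (simp add: energy_def)
qed

lemma multiplicity:
  assumes kap: "\<kappa> = frac_const s TYPE('a) / 4"
    and h: "continuous_on {0..} h" "h 0 = 0" and e: "continuous_on {0..} e" "e 0 = 0"
    and inf: "infinite (negative_levels h)"
  shows "\<exists>\<Lambda>>0. \<forall>c\<in>{-\<Lambda>..\<Lambda>}. has_k_positive_solutions k s \<Omega> (\<lambda>t. if t > 0 then h t + c * e t else 0)"
proof -
  have hc: "continuous_on {0..b} h" "continuous_on {0..b} e" for b
    by (rule continuous_on_subset[OF h(1)], force, rule continuous_on_subset[OF e(1)], force)
  obtain S where S: "finite S" "card S = k" "S \<subseteq> negative_levels h"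
    using infinite_arbitrarily_large[OF inf] by blast
  obtain m where m: "bij_betw m {0..<k} S" using ex_bij_betw_nat_finite[OF S(1)] S(2) by blast
  have "\<exists>d. d > 0 \<and> h d < 0 \<and> ground h d = m i \<and> m i < 0" if "i < k" for i
  proof -
    have "m i \<in> negative_levels h" using bij_betwE[OF m] S(3) that by auto
    then show ?thesis by (auto simp: negative_levels_def)
  qed
  then obtain D where D: "\<And>i. i < k \<Longrightarrow> D i > 0 \<and> h (D i) < 0 \<and> ground h (D i) = m i \<and> m i < 0" by metis
  define H where "H c r = h r + c * e r" for c r
  have lim: "((\<lambda>c. ground (H c) (D i)) \<longlongrightarrow> m i) (nhds 0)" if "i < k" for i
    using ground_perturb[OF hc, of "D i"] D[OF that] unfolding H_def by simp
  \<comment> \<open>All requirements are strict inequalities at \<open>c\<close> = 0, finite in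
    number, so a common neighbourhood serves for every index.\<close>
  have e1: "\<forall>\<^sub>F c in nhds 0. \<forall>i\<in>{..<k}. H c (D i) < 0 \<and> ground (H c) (D i) < 0"
  proof (intro eventually_ball_finite ballI eventually_conj)
    fix i assume "i \<in> {..<k}"
    then have i: "i < k" by simp
    have "((\<lambda>c. H c (D i)) \<longlongrightarrow> h (D i) + 0 * e (D i)) (nhds 0)"
      unfolding H_def
      by (rule tendsto_add[OF tendsto_const tendsto_mult[OF filterlim_ident tendsto_const]])
    then show "\<forall>\<^sub>F c in nhds 0. H c (D i) < 0" by (rule order_tendstoD) (use D[OF i] in simp)
    show "\<forall>\<^sub>F c in nhds 0. ground (H c) (D i) < 0"
      by (rule order_tendstoD(2)[OF lim[OF i]]) (use D[OF i] in simp)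
  qed simp
  have e2: "\<forall>\<^sub>F c in nhds 0. \<forall>i\<in>{..<k}. \<forall>j\<in>{..<k}. i \<noteq> j \<longrightarrow> ground (H c) (D i) \<noteq> ground (H c) (D j)"
  proof (intro eventually_ball_finite ballI)
    fix i j assume ij: "i \<in> {..<k}" "j \<in> {..<k}"
    show "\<forall>\<^sub>F c in nhds 0. i \<noteq> j \<longrightarrow> ground (H c) (D i) \<noteq> ground (H c) (D j)"
    proof (cases "i = j")
      case False
      have "m i \<noteq> m j" using m ij False by (auto simp: bij_betw_def inj_on_def)
      moreover have "((\<lambda>c. ground (H c) (D i) - ground (H c) (D j)) \<longlongrightarrow> m i - m j) (nhds 0)"
        using ij by (intro tendsto_diff lim) auto
      ultimately have "\<forall>\<^sub>F c in nhds 0. ground (H c) (D i) - ground (H c) (D j) \<noteq> 0"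
        by (intro tendsto_imp_eventually_ne) auto
      then show ?thesis by (auto elim: eventually_mono)
    qed simp
  qed simp_all
  obtain \<epsilon> where \<epsilon>: "\<epsilon> > 0" "\<And>c. \<bar>c\<bar> < \<epsilon> \<Longrightarrow> (\<forall>i<k. H c (D i) < 0 \<and> ground (H c) (D i) < 0) \<and>
      (\<forall>i<k. \<forall>j<k. i \<noteq> j \<longrightarrow> ground (H c) (D i) \<noteq> ground (H c) (D j))"
    using eventually_conj[OF e1 e2] unfolding eventually_nhds_metric by (auto simp: dist_real_def)
  have "has_k_positive_solutions k s \<Omega> (\<lambda>t. if t > 0 then h t + c * e t else 0)" if c: "\<bar>c\<bar> < \<epsilon>" for c
  proof -
    have Hc: "continuous_on {0..} (H c)" unfolding H_def by (intro continuous_intros h e)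
    have Hcd: "continuous_on {0..b} (H c)" for b by (rule continuous_on_subset[OF Hc]) auto
    have H0: "H c 0 = 0" by (simp add: H_def h e)
    have "\<exists>w\<in>W (D i). energy (H c) w = ground (H c) (D i)" if "i < k" for i
      using minimizer_exists[OF Hcd, of "D i"] D[OF that] by (metis less_imp_le)
    then obtain U where U: "\<And>i. i < k \<Longrightarrow> U i \<in> W (D i) \<and> energy (H c) (U i) = ground (H c) (D i)" by metis
    have pos: "positive_weak_solution s \<Omega> (\<lambda>t. if t > 0 then H c t else 0) (U i)" if i: "i < k" for i
    proof -
      have "weak_solution s \<Omega> (\<lambda>t. if t > 0 then H c t else 0) (U i)"
        using U[OF i] D[OF i] \<epsilon>(2)[OF c] i
        by (intro minimizer_weak_solution[OF kap Hcd H0, of "D i"]) auto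
      moreover have "AE x in lborel. U i x \<ge> 0" using U[OF i] by (auto simp: W_def)
      moreover have "\<not> (AE x in lborel. U i x = 0)"
      proof
        assume "AE x in lborel. U i x = 0"
        then have "energy (H c) (U i) = energy (H c) (\<lambda>_. 0)"
          using U[OF i] by (intro energy_cong_AE[OF _ zero_in_W[of 0] Hc]) auto
        also have "\<dots> = 0" by (simp add: energy_def gagliardo_def case_prod_unfold)
        finally show False using U[OF i] \<epsilon>(2)[OF c] i by force
      qed
      ultimately show ?thesis by (simp add: positive_weak_solution_def)
    qed
    have "\<not> (AE x in lborel. U i x = U j x)" if ij: "i < k" "j < k" "i \<noteq> j" for i j
      using energy_cong_AE[of "U i" "D i" "U j" "D j", OF _ _ Hc] U[OF ij(1)] U[OF ij(2)] \<epsilon>(2)[OF c] ij by metis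
    with pos show ?thesis unfolding has_k_positive_solutions_def H_def by blast
  qed
  then show ?thesis using \<epsilon>(1) by (intro exI[of _ "\<epsilon> / 2"]) auto
qed

end

section \<open>Oscillation conditions\<close>

lemma powr_diff_bound:
  assumes "t > (0::real)" "t powr (a - 1) \<le> b"
  shows "t powr a \<le> b * t"
proof -
  have "t powr a = t powr (a - 1) * t" using assms(1) by (simp add: powr_diff)
  also have "\<dots> \<le> b * t" using assms by (intro mult_right_mono) auto
  finally show ?thesis .
qed

lemma continuous_on_powr_nonneg: "a > 0 \<Longrightarrow> continuous_on {0..} (\<lambda>t::real. t powr a)"
  by (intro continuous_on_powr') (auto intro: continuous_intros)

text \<open>The integrand is increasing, so it is at most its final value, which is at most
  \<open>t\<close>; comparison with \<open>t\<^sup>2\<close> is all that the quadratic quotients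
  need.\<close>

lemma abs_primF_powr_le:
  assumes "a > 0" "t > 0" "t powr a \<le> t"
  shows "\<bar>primF (\<lambda>t. t powr a) t\<bar> \<le> t\<^sup>2"
proof -
  have "norm (integral {0..t} (\<lambda>t. t powr a)) \<le> t * (t - 0)"
  proof (rule integral_bound)
    show "continuous_on {0..t} (\<lambda>t. t powr a)"
      by (rule continuous_on_subset[OF continuous_on_powr_nonneg[OF assms(1)]]) auto
    show "norm (r powr a) \<le> t" if "r \<in> {0..t}" for r
      using powr_mono2[of a r t] assms that by auto
  qed (use assms in auto)
  then show ?thesis by (simp add: primF_def power2_eq_square)
qed

text \<open>One filter argument for both regimes: the hypothesis \<open>small\<close> says that
  \<open>t powr a\<close> is o(t), so the added term changes the primitive by at most a multiple of
  \<open>t\<^sup>2\<close> and cannot offset a negative lower limit of f(t)/t.\<close>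

lemma perturbed_growth:
  fixes F :: "real filter" and c :: real
  assumes F: "\<forall>\<^sub>F t in F. t > 0" "F \<noteq> bot"
    and f: "continuous_on {0..} f" and a: "a > 0"
    and small: "((\<lambda>t. t powr (a - 1)) \<longlongrightarrow> 0) F"
    and inf: "Liminf F (\<lambda>t. ereal (primF f t / t\<^sup>2)) > -\<infinity>"
    and sup: "Limsup F (\<lambda>t. ereal (primF f t / t\<^sup>2)) = \<infinity>"
    and neg: "Liminf F (\<lambda>t. ereal (f t / t)) < 0"
  defines "h \<equiv> \<lambda>t. f t + c * t powr a"
  shows "\<exists>l. \<forall>\<^sub>F t in F. primF h t \<ge> - (l * t\<^sup>2)"
    and "\<exists>\<^sub>F t in F. primF h t > M * t\<^sup>2"
    and "\<exists>\<^sub>F t in F. h t < 0"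
proof -
  have sm: "\<forall>\<^sub>F t in F. t > 0 \<and> t powr a \<le> \<epsilon> * t" if "\<epsilon> > 0" for \<epsilon>
    using order_tendstoD(2)[OF small that] F(1)
    by eventually_elim (use powr_diff_bound in auto)
  have cl: "\<forall>\<^sub>F t in F. t > 0 \<and> \<bar>primF h t - primF f t\<bar> \<le> \<bar>c\<bar> * t\<^sup>2"
    using sm[of 1, OF zero_less_one]
  proof eventually_elim
    case (elim t)
    have "primF h t = primF f t + c * primF (\<lambda>t. t powr a) t"
      unfolding h_def
      by (intro primF_add_scale continuous_on_subset[OF f] continuous_on_subset[OF continuous_on_powr_nonneg[OF a]]) auto
    then show ?case using abs_primF_powr_le[OF a, of t] elim by (simp add: abs_mult mult_left_mono)
  qed
  show "\<exists>l. \<forall>\<^sub>F t in F. primF h t \<ge> - (l * t\<^sup>2)"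
  proof -
    obtain r :: real where "ereal r < Liminf F (\<lambda>t. ereal (primF f t / t\<^sup>2))"
      using ereal_dense2[OF inf] by blast
    then have "\<forall>\<^sub>F t in F. r < primF f t / t\<^sup>2" by (auto dest: less_LiminfD)
    then have "\<forall>\<^sub>F t in F. primF h t \<ge> - ((\<bar>c\<bar> - r) * t\<^sup>2)"
      using cl
    proof eventually_elim
      case (elim t)
      then have "r * t\<^sup>2 < primF f t" by (simp add: pos_less_divide_eq)
      then show ?case using elim(2) by (simp add: algebra_simps abs_le_iff)
    qed
    then show ?thesis ..
  qed
  show "\<exists>\<^sub>F t in F. primF h t > M * t\<^sup>2"
  proof -
    \<comment> \<open>The extra |c| compensates the change of the primitive bounded in
      \<open>cl\<close>.\<close>
    have fr: "\<exists>\<^sub>F t in F. primF f t / t\<^sup>2 > M + \<bar>c\<bar>"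
    proof (rule ccontr)
      assume "\<not> ?thesis"
      then have "\<forall>\<^sub>F t in F. ereal (primF f t / t\<^sup>2) \<le> ereal (M + \<bar>c\<bar>)"
        by (simp add: frequently_def not_less)
      then have "Limsup F (\<lambda>t. ereal (primF f t / t\<^sup>2)) \<le> ereal (M + \<bar>c\<bar>)" by (rule Limsup_bounded)
      then show False using sup by simp
    qed
    show ?thesis
    proof (rule frequently_rev_mp[OF fr], use cl in eventually_elim, intro impI)
      fix t assume "t > 0 \<and> \<bar>primF h t - primF f t\<bar> \<le> \<bar>c\<bar> * t\<^sup>2" "primF f t / t\<^sup>2 > M + \<bar>c\<bar>"
      then have "(M + \<bar>c\<bar>) * t\<^sup>2 < primF f t" "\<bar>primF h t - primF f t\<bar> \<le> \<bar>c\<bar> * t\<^sup>2" by (auto simp: pos_less_divide_eq)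
      then show "M * t\<^sup>2 < primF h t" by (simp add: algebra_simps abs_le_iff)
    qed
  qed
  show "\<exists>\<^sub>F t in F. h t < 0"
  proof -
    obtain r :: real where r: "Liminf F (\<lambda>t. ereal (f t / t)) < ereal r" "ereal r < 0"
      using ereal_dense2[OF neg] by blast
    have fr: "\<exists>\<^sub>F t in F. f t / t < r"
    proof (rule ccontr)
      assume "\<not> ?thesis"
      then have "\<forall>\<^sub>F t in F. ereal r \<le> ereal (f t / t)"
        by (simp add: frequently_def not_less)
      then have "ereal r \<le> Liminf F (\<lambda>t. ereal (f t / t))" by (rule Liminf_bounded)
      then show False using r by simp
    qed
    \<comment> \<open>Chosen so that the perturbation is at most \<open>- r * t\<close>, while f(t)
      < r t frequently; the 1 in the denominator covers \<open>c\<close> = 0.\<close>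
    define \<epsilon> where "\<epsilon> = - r / (\<bar>c\<bar> + 1)"
    have \<epsilon>: "\<epsilon> > 0" "\<bar>c\<bar> * \<epsilon> \<le> - r" using r(2) by (auto simp: \<epsilon>_def field_simps)
    show ?thesis
    proof (rule frequently_rev_mp[OF fr], use sm[OF \<epsilon>(1)] in eventually_elim, intro impI)
      fix t assume t: "t > 0 \<and> t powr a \<le> \<epsilon> * t" "f t / t < r"
      then have "f t < r * t" by (simp add: pos_divide_less_eq)
      have "c * t powr a \<le> \<bar>c\<bar> * t powr a" by (intro mult_right_mono) auto
      also have "\<dots> \<le> \<bar>c\<bar> * (\<epsilon> * t)" using t by (intro mult_left_mono) auto
      also have "\<dots> = (\<bar>c\<bar> * \<epsilon>) * t" by simp
      also have "\<dots> \<le> - r * t" using \<epsilon> t by (intro mult_right_mono) auto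
      finally show "h t < 0" using \<open>f t < r * t\<close> by (simp add: h_def)
    qed
  qed
qed

lemma bounded_smooth_domain_open: "bounded_smooth_domain \<Omega> \<Longrightarrow> open \<Omega>"
proof -
  assume "bounded_smooth_domain \<Omega>"
  then obtain \<rho> where \<rho>: "smooth_fun \<rho>" "\<Omega> = {x. \<rho> x < 0}" by (auto simp: bounded_smooth_domain_def)
  have "Ck_fun 0 \<rho>" using \<rho>(1) unfolding smooth_fun_def by blast
  then have "continuous_on UNIV \<rho>" by simp
  then show "open \<Omega>" unfolding \<rho>(2) by (intro open_Collect_less continuous_on_const)
qed

theorem theorem6p1:
  fixes \<Omega> :: "'a::euclidean_space set" and s p q :: real and f :: "real \<Rightarrow> real"
  assumes "bounded_smooth_domain \<Omega>"
    and "0 < s" "s < 1" "real DIM('a) > 2 * s"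
    and "continuous_on {0..} f" "f 0 = 0"
    and "0 < p" "p < 1" "1 < q"
  shows "(cond_f0 f \<longrightarrow>
           (\<forall>k::nat. \<forall>\<mu>::real. \<exists>\<Lambda>>0. \<forall>lam\<in>{-\<Lambda>..\<Lambda>}.
              has_k_positive_solutions k s \<Omega> (nonlin lam \<mu> p q f)))
       \<and> (cond_finf f \<longrightarrow>
           (\<forall>k::nat. \<forall>lam::real. \<exists>M>0. \<forall>\<mu>\<in>{-M..M}.
              has_k_positive_solutions k s \<Omega> (nonlin lam \<mu> p q f)))"
proof (intro conjI impI allI)
  define \<kappa> where "\<kappa> = frac_const s TYPE('a) / 4"
  interpret truncated_problem \<Omega> s \<kappa>
    using assms bounded_smooth_domain_open[of \<Omega>] frac_const_pos[of s, where 'a='a]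
    by unfold_locales (auto simp: \<kappa>_def bounded_smooth_domain_def)
  note f = assms(5,6) and pq = assms(7-9)
  have cont: "continuous_on {0..} (\<lambda>t. f t + c * t powr a)" if "a > 0" for a c
    using that by (intro continuous_intros f continuous_on_powr_nonneg)
  {
    fix k :: nat and \<mu> :: real
    assume c: "cond_f0 f"
    \<comment> \<open>The power with exponent \<open>q\<close> > 1 belongs to the unperturbed part,
      so \<open>\<mu>\<close> is arbitrary; \<open>lam\<close> is the small parameter.\<close>
    let ?h = "\<lambda>t. f t + \<mu> * t powr q"
    have gt: "\<forall>\<^sub>F t in at_right (0::real). t > 0" by (rule eventually_at_right_less)
    moreover have "((\<lambda>t::real. t powr (q - 1)) \<longlongrightarrow> 0) (at_right 0)"
      by (rule tendsto_zero_powrI[OF tendsto_ident_at tendsto_const eventually_mono[OF gt]]) (use pq in auto)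
    ultimately have g: "\<exists>l. \<forall>\<^sub>F t in at_right 0. primF ?h t \<ge> - (l * t\<^sup>2)"
      "\<exists>\<^sub>F t in at_right 0. primF ?h t > M * t\<^sup>2" "\<exists>\<^sub>F t in at_right 0. ?h t < 0" for M
      using perturbed_growth[where F="at_right 0" and f=f and a=q and c=\<mu>] c f pq by (auto simp: cond_f0_def)
    obtain l where l: "\<forall>\<^sub>F t in at_right 0. primF ?h t \<ge> - (l * t\<^sup>2)" using g(1) by blast
    have h: "continuous_on {0..} ?h" "?h 0 = 0" using cont pq f by auto
    have "infinite (negative_levels ?h)" by (rule infinite_levels_at_0[OF h(1) l g(2,3)])
    moreover have "nonlin lam \<mu> p q f = (\<lambda>t. if t > 0 then ?h t + lam * t powr p else 0)" for lam
      by (auto simp: nonlin_def fun_eq_iff)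
    ultimately show "\<exists>\<Lambda>>0. \<forall>lam\<in>{-\<Lambda>..\<Lambda>}. has_k_positive_solutions k s \<Omega> (nonlin lam \<mu> p q f)"
      using multiplicity[OF \<kappa>_def h continuous_on_powr_nonneg[OF pq(1)] ] pq by simp
  next
    fix k :: nat and lam :: real
    assume c: "cond_finf f"
    \<comment> \<open>The roles are exchanged: at infinity the sublinear power is the harmless one,
      and \<open>\<mu>\<close> is the small parameter.\<close>
    let ?h = "\<lambda>t. f t + lam * t powr p"
    have "((\<lambda>t::real. t powr (p - 1)) \<longlongrightarrow> 0) at_top"
      using pq by (intro tendsto_neg_powr filterlim_ident) auto
    then have g: "\<exists>l. \<forall>\<^sub>F t in at_top. primF ?h t \<ge> - (l * t\<^sup>2)"
      "\<exists>\<^sub>F t in at_top. primF ?h t > M * t\<^sup>2" "\<exists>\<^sub>F t in at_top. ?h t < 0" for M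
      using perturbed_growth[where F=at_top and f=f and a=p and c=lam] c f pq by (auto simp: cond_finf_def eventually_gt_at_top)
    obtain l where l: "\<forall>\<^sub>F t in at_top. primF ?h t \<ge> - (l * t\<^sup>2)" using g(1) by blast
    have h: "continuous_on {0..} ?h" "?h 0 = 0" using cont pq f by auto
    have "infinite (negative_levels ?h)" by (rule infinite_levels_at_top[OF h(1) l g(2,3)])
    moreover have "nonlin lam \<mu> p q f = (\<lambda>t. if t > 0 then ?h t + \<mu> * t powr q else 0)" for \<mu>
      by (auto simp: nonlin_def fun_eq_iff)
    ultimately show "\<exists>M>0. \<forall>\<mu>\<in>{-M..M}. has_k_positive_solutions k s \<Omega> (nonlin lam \<mu> p q f)"
      using multiplicity[OF \<kappa>_def h continuous_on_powr_nonneg[of q] ] pq by simp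
  }
qed

end
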